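(* There exists $\tilde p<1$ such that, for every $p$ with $\tilde p\le p<1$, every box $\Lambda$, every $\ell\ge2$, every $t\in\mathbb N$, every $s\in\{0,\dots,|\Lambda|\}$ and every edge $e\subset\Lambda$ at distance more than $\ell$ from $\Lambda^c$, $$P_\mu\Big(e\in\mathcal P_{t+s},\ \forall r\in[t,t+s]\ \ \mathcal P_r\ne\emptyset\ \Big|\ \exists c_t\in\mathcal C_t,\ d(e,c_t)\ge\ell\Big)\le\exp(-\ell).$$
   Context: Fix an integer $d\ge 2$. $\mathbb E^d$ is the set of pairs $\{x,y\}$ of points of $\mathbb Z^d$ at Euclidean distance $1$; an edge is identified with the corresponding closed unit segment. $\Lambda$ is a closed cubic box of positive side length in $\mathbb R^d$, centred at the origin, with sides parallel to the axes and corners in $\mathbb Z^d$; $|\Lambda|$ is the cardinality of $\Lambda\cap\mathbb Z^d$; $\Lambda^c=\mathbb R^d\setminus\Lambda$; $T$ and $B$ are the top and bottom sides (faces) of $\Lambda$. A configuration is a map $\omega$ from the set of edges included in $\Lambda$ to $\{0,1\}$; $e$ is open if $\omega(e)=1$, closed if $\omega(e)=0$. $T\overset{\omega}{\longleftrightarrow}B$ means that a path of open edges joins a vertex of $T$ to a vertex of $B$. $\omega^e$ is the configuration obtained from $\omega$ by opening $e$. Coupling. Let $0<p<1$. Let $(E_t)_{t\ge1}$ be i.i.d. uniform on the edges included in $\Lambda$ and $(B_t)_{t\ge1}$ i.i.d. Bernoulli($p$), all independent of each other and of $(X_0,Y_0)$. For $t\ge1$: $X_t(e)=X_{t-1}(e)$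 and $Y_t(e)=Y_{t-1}(e)$ for $e\ne E_t$; $X_t(E_t)=B_t$; $Y_t(E_t)=1$ if $B_t=1$ and $T$ is not connected to $B$ in $Y_{t-1}^{E_t}$, and $Y_t(E_t)=0$ otherwise. This Markov chain, on the set of pairs $(\omega_1,\omega_2)$ with $\omega_1\ge\omega_2$ edgewise and $T$ not connected to $B$ in $\omega_2$, has a unique equilibrium distribution $\mu_p$; $P_\mu$ is the law of $(X_t,Y_t)_{t\in\mathbb N}$ when $(X_0,Y_0)$ has law $\mu_p$. $\mathcal P_t=\{e\subset\Lambda:T\overset{Y_t^e}{\longleftrightarrow}B\}$ is the set of pivotal edges in $Y_t$. A set $S$ of edges of $\Lambda$ separates $T$ and $B$ if every path of edges from $T$ to $B$ in $\Lambda$ intersects $S$; a cut is a separating set that is minimal for inclusion; $\mathcal C_t$ is the collection of the cuts all of whose edges are closed in $Y_t$. $d(\cdot,\cdot)$ is Euclidean distance (between sets, the infimum), a set of edges being viewed as the union of its segments; $d$ alone is the dimension. Times are integers. The conditional inequality is understood when the conditioning event has positive probability. The constant $\tilde p$ depends only on $d$. *)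

theory Defs
  imports "HOL-Probability.Probability"
begin

type_synonym 'd edge = "(real ^ 'd) set"

text \<open>A configuration is a map on the edges included in the box; \<open>True\<close> stands for 1 (open) and
  \<open>False\<close> for 0 (closed). Maps are extensional, i.e. equal to \<open>undefined\<close> at all other arguments.\<close>
type_synonym 'd config = "'d edge \<Rightarrow> bool"


section \<open>Lattice, boxes and edges\<close>

definition lattice :: "(real ^ 'd) set" where
  "lattice = {x. \<forall>i. x $ i \<in> \<int>}"

definition lattice_edges :: "'d::finite edge set" where
  "lattice_edges = {{x, y} | x y. x \<in> lattice \<and> y \<in> lattice \<and> dist x y = 1}"

text \<open>The convex hull of an edge \<open>{x, y}\<close> is the closed segment from \<open>x\<close> to \<open>y\<close>.\<close>
definition segment_union :: "'d::finite edge set \<Rightarrow> (real ^ 'd) set" where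
  "segment_union S = (\<Union>e\<in>S. convex hull e)"

text \<open>A closed cube centred at the origin has its corners in the lattice iff half its side length
  is an integer; \<open>m\<close> is this half side length.\<close>
definition Box :: "nat \<Rightarrow> (real ^ 'd::finite) set" where
  "Box m = cbox (\<chi> i. - real m) (\<chi> i. real m)"

definition box_edges :: "nat \<Rightarrow> 'd::finite edge set" where
  "box_edges m = {e \<in> lattice_edges. convex hull e \<subseteq> Box m}"

text \<open>The coordinate \<open>k\<close> plays the role of the vertical direction.\<close>
definition top_side :: "'d::finite \<Rightarrow> nat \<Rightarrow> (real ^ 'd) set" where
  "top_side k m = {x \<in> Box m. x $ k = real m}"

definition bottom_side :: "'d::finite \<Rightarrow> nat \<Rightarrow> (real ^ 'd) set" where
  "bottom_side k m = {x \<in> Box m. x $ k = - real m}"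


section \<open>Paths, connection, pivotal edges and cuts\<close>

definition path_edges :: "(real ^ 'd) list \<Rightarrow> 'd edge set" where
  "path_edges xs = {{x, y} | x y. (x, y) \<in> set (zip xs (tl xs))}"

definition crossing_path :: "'d::finite \<Rightarrow> nat \<Rightarrow> (real ^ 'd) list \<Rightarrow> bool" where
  "crossing_path k m xs \<longleftrightarrow> xs \<noteq> [] \<and> set xs \<subseteq> lattice \<and> path_edges xs \<subseteq> box_edges m \<and>
     hd xs \<in> top_side k m \<and> last xs \<in> bottom_side k m"

definition top_bottom_connected :: "'d::finite \<Rightarrow> nat \<Rightarrow> 'd config \<Rightarrow> bool" where
  "top_bottom_connected k m \<eta> \<longleftrightarrow> (\<exists>xs. crossing_path k m xs \<and> (\<forall>e\<in>path_edges xs. \<eta> e))"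

definition pivotal :: "'d::finite \<Rightarrow> nat \<Rightarrow> 'd config \<Rightarrow> 'd edge set" where
  "pivotal k m \<eta> = {e \<in> box_edges m. top_bottom_connected k m (\<eta>(e := True))}"

definition separates :: "'d::finite \<Rightarrow> nat \<Rightarrow> 'd edge set \<Rightarrow> bool" where
  "separates k m S \<longleftrightarrow> S \<subseteq> box_edges m \<and> (\<forall>xs. crossing_path k m xs \<longrightarrow> path_edges xs \<inter> S \<noteq> {})"

definition is_cut :: "'d::finite \<Rightarrow> nat \<Rightarrow> 'd edge set \<Rightarrow> bool" where
  "is_cut k m S \<longleftrightarrow> separates k m S \<and> (\<forall>S'. S' \<subset> S \<longrightarrow> \<not> separates k m S')"

definition closed_cuts :: "'d::finite \<Rightarrow> nat \<Rightarrow> 'd config \<Rightarrow> 'd edge set set" where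
  "closed_cuts k m \<eta> = {c. is_cut k m c \<and> (\<forall>e\<in>c. \<not> \<eta> e)}"


section \<open>The coupled dynamics\<close>

definition configs :: "nat \<Rightarrow> 'd::finite config set" where
  "configs m = box_edges m \<rightarrow>\<^sub>E UNIV"

definition coupling_states :: "'d::finite \<Rightarrow> nat \<Rightarrow> ('d config \<times> 'd config) set" where
  "coupling_states k m = {(\<eta>\<^sub>1, \<eta>\<^sub>2). \<eta>\<^sub>1 \<in> configs m \<and> \<eta>\<^sub>2 \<in> configs m \<and>
     (\<forall>e\<in>box_edges m. \<eta>\<^sub>2 e \<le> \<eta>\<^sub>1 e) \<and> \<not> top_bottom_connected k m \<eta>\<^sub>2}"

fun coupling_step :: "'d::finite \<Rightarrow> nat \<Rightarrow> 'd edge \<times> bool \<Rightarrow> 'd config \<times> 'd config \<Rightarrow> 'd config \<times> 'd config"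
  where
  "coupling_step k m (e, b) (x, y) =
     (x(e := b), y(e := (b \<and> \<not> top_bottom_connected k m (y(e := True)))))"

text \<open>Joint law of \<open>(E\<^sub>t, B\<^sub>t)\<close> at one time \<open>t\<close>.\<close>
definition coupling_noise :: "real \<Rightarrow> nat \<Rightarrow> ('d::finite edge \<times> bool) pmf" where
  "coupling_noise p m = pair_pmf (pmf_of_set (box_edges m)) (bernoulli_pmf p)"

definition equilibrium ::
    "'d::finite \<Rightarrow> nat \<Rightarrow> real \<Rightarrow> ('d config \<times> 'd config) pmf \<Rightarrow> bool" where
  "equilibrium k m p \<mu> \<longleftrightarrow> set_pmf \<mu> \<subseteq> coupling_states k m \<and>
     bind_pmf \<mu> (\<lambda>z. map_pmf (\<lambda>n. coupling_step k m n z) (coupling_noise p m)) = \<mu>"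

text \<open>Restricting to the (here finite) support makes every event that depends on finitely many
  coordinates measurable in the product below. With \<open>measure_pmf\<close> itself this can fail, since the
  underlying types are uncountable.\<close>
definition on_support :: "'a pmf \<Rightarrow> 'a measure" where
  "on_support q = restrict_space (measure_pmf q) (set_pmf q)"

text \<open>The sample points are pairs \<open>((X\<^sub>0, Y\<^sub>0), (E\<^sub>t, B\<^sub>t)\<^bsub>t \<ge> 1\<^esub>)\<close>, all components independent.\<close>
definition coupling_space ::
    "nat \<Rightarrow> real \<Rightarrow> ('d::finite config \<times> 'd config) pmf \<Rightarrow>
     (('d config \<times> 'd config) \<times> (nat \<Rightarrow> 'd edge \<times> bool)) measure" where
  "coupling_space m p \<mu> = on_support \<mu> \<Otimes>\<^sub>M (\<Pi>\<^sub>M t\<in>{1..}. on_support (coupling_noise p m))"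

primrec coupled_chain ::
    "'d::finite \<Rightarrow> nat \<Rightarrow> nat \<Rightarrow> ('d config \<times> 'd config) \<times> (nat \<Rightarrow> 'd edge \<times> bool) \<Rightarrow>
     'd config \<times> 'd config" where
  "coupled_chain k m 0 w = fst w"
| "coupled_chain k m (Suc t) w = coupling_step k m (snd w (Suc t)) (coupled_chain k m t w)"

definition constrained_config :: "'d::finite \<Rightarrow> nat \<Rightarrow> nat \<Rightarrow> ('d config \<times> 'd config) \<times> (nat \<Rightarrow> 'd edge \<times> bool) \<Rightarrow>
     'd config" where
  "constrained_config k m t w = snd (coupled_chain k m t w)"

end

theory Submission
  imports Defs
begin

text \<open>Call an edge \<open>bad\<close> (for the time window from \<open>t\<close> to \<open>t + s\<close>) if it is closed in \<open>Y\<^sub>t\<close> or if at some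
  time in the window it is selected together with the value 0. In the dynamics an edge can only become
  closed when it receives the value 0: if it is selected with the value 1 and refused because it is
  pivotal, then it was closed before, since opening it would connect top and bottom. Hence every edge that
  is closed at some time of the window is bad (\<open>closed_imp_bad\<close>).

  The geometric part produces a chain of bad edges from \<open>e\<close> to the distant cut \<open>c\<^sub>t\<close>. Two edges are
  adjacent if they have endpoints at distance at most 1. Let \<open>K\<close> be the set of bad edges that can be reached
  from \<open>e\<close> through adjacent bad edges, and suppose that \<open>K\<close> misses \<open>c\<^sub>t\<close>. Then at every time of
  the window the closed edges outside \<open>K\<close> separate top and bottom. For if this fails for the first time
  when an edge opens, the closed edges of \<open>K\<close> separate (\<open>separating_union\<close>); they did so already before
  the opening, together with the disjoint set of the closed edges outside \<open>K\<close>, although both sets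
  contain every pivotal edge and there is one. At the final time the same remark
  applied to the pivotal edge \<open>e \<in> K\<close> gives a contradiction. So there is a chain of distinct bad edges
  that starts at \<open>e\<close> and has a length of order \<open>l\<close> (\<open>long_bad_chain\<close>).

  That a separating set made of two non-adjacent parts has a separating part is the discrete counterpart of
  the connectedness of minimal cuts. It follows from the vanishing of the first cohomology of a box with
  coefficients in the field with two elements (\<open>exact_parity_cochain\<close>): the edge boundary of the set
  reached from the top is a cocycle, each of its two parts is one as well, and so each part is itself
  the boundary of a set of vertices.

  For the probabilistic part, the constrained configuration in equilibrium is Bernoulli percolation
  conditioned on disconnection (\<open>equilibrium_marginal\<close>). The existence of a closed cut at distance at least
  \<open>l\<close> from \<open>e\<close> depends only on the edges far from \<open>e\<close>, and it already implies disconnection; under this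
  condition the edges near \<open>e\<close> are therefore still independent and closed with probability \<open>1 - p\<close>. The
  noise after time \<open>t\<close> is independent of the state at time \<open>t\<close> (\<open>present_state_indep_future_noise\<close>), and as
  \<open>s\<close> is at most twice the number of edges, an edge receives the value 0 in the window with
  probability at most \<open>2 (1 - p)\<close>. A given chain of \<open>n\<close> edges near \<open>e\<close> is bad with probability
  at most \<open>(3 (1 - p)) ^ n\<close> (\<open>prob_all_bad_le\<close>), and the number of chains grows only exponentially in \<open>n\<close>
  with a rate depending only on the dimension.\<close>

section \<open>Parity cochains on integer boxes\<close>

definition step_up :: "'d \<Rightarrow> ('d \<Rightarrow> int) \<Rightarrow> ('d \<Rightarrow> int)" where
  "step_up i x = x(i := x i + 1)"

definition int_box :: "('d \<Rightarrow> int) \<Rightarrow> ('d \<Rightarrow> int) \<Rightarrow> ('d \<Rightarrow> int) set" where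
  "int_box lo hi = {x. \<forall>i. lo i \<le> x i \<and> x i \<le> hi i}"

lemma step_up_commute: "i \<noteq> j \<Longrightarrow> step_up i (step_up j x) = step_up j (step_up i x)"
  by (auto simp: step_up_def fun_eq_iff)

lemma step_up_induct [consumes 1, case_names base step]:
  fixes x :: "'d \<Rightarrow> int"
  assumes x: "x \<in> int_box lo hi"
    and base: "\<And>x. x \<in> int_box lo hi \<Longrightarrow> x j = lo j \<Longrightarrow> P x"
    and step: "\<And>x. x \<in> int_box lo hi \<Longrightarrow> step_up j x \<in> int_box lo hi \<Longrightarrow> P x \<Longrightarrow> P (step_up j x)"
  shows "P x"
  using x
proof (induction "nat (x j - lo j)" arbitrary: x)
  case 0
  then show ?case using base[of x] by (auto simp: int_box_def intro: antisym)
next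
  case (Suc n)
  let ?y = "x(j := x j - 1)"
  have sy: "step_up j ?y = x" by (auto simp: step_up_def)
  have y: "?y \<in> int_box lo hi"
    using Suc by (auto simp: int_box_def) (smt (verit))
  have "P ?y" using Suc y by (intro Suc(1)) auto
  then show ?case using step[of ?y] y sy Suc by auto
qed

text \<open>Moving the coordinates one after the other to their lower bounds joins every point of the box to the
  same corner.\<close>
lemma constant_on_int_box:
  fixes g :: "('d::finite \<Rightarrow> int) \<Rightarrow> 'b"
  assumes g: "\<And>i x. x \<in> int_box lo hi \<Longrightarrow> step_up i x \<in> int_box lo hi \<Longrightarrow> g (step_up i x) = g x"
    and xy: "x \<in> int_box lo hi" "y \<in> int_box lo hi"
  shows "g x = g y"
proof -
  have line: "g x = g (x(i := lo i))" if "x \<in> int_box lo hi" for i x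
    using that
  proof (induction x rule: step_up_induct[where j = i])
    case (base x)
    then show ?case by (metis fun_upd_triv)
  next
    case (step x)
    have "(step_up i x)(i := lo i) = x(i := lo i)" by (simp add: step_up_def)
    then show ?case using g[OF step(1,2)] step by simp
  qed
  have "g x = g (\<lambda>i. if i \<in> I then lo i else x i)" if "x \<in> int_box lo hi" for I x
    using finite[of I] that
  proof (induction I arbitrary: x rule: finite_induct)
    case empty
    then show ?case by simp
  next
    case (insert j I)
    have "x(j := lo j) \<in> int_box lo hi"
      using insert.prems by (auto simp: int_box_def) (smt (verit))
    then have "g (x(j := lo j)) = g (\<lambda>i. if i \<in> I then lo i else (x(j := lo j)) i)"
      by (rule insert.IH)
    also have "(\<lambda>i. if i \<in> I then lo i else (x(j := lo j)) i) = (\<lambda>i. if i \<in> insert j I then lo i else x i)"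
      by auto
    finally have "g (x(j := lo j)) = g (\<lambda>i. if i \<in> insert j I then lo i else x i)" .
    with line[OF insert.prems, of j] show ?case by (rule trans)
  qed
  from this[of _ UNIV] show ?thesis using xy by simp
qed

text \<open>The Poincare lemma with coefficients in the field with two elements: if the values of \<open>\<phi>\<close> on the edges
  have even sum around each unit square, then \<open>\<phi>\<close> is a coboundary. The potential \<open>g\<close> is built by induction on
  the set of directions in which it has to be correct; a new direction \<open>j\<close> is handled by starting from the old
  potential on the face \<open>x j = lo j\<close> and summing \<open>\<phi>\<close> along the line in direction \<open>j\<close>.\<close>
lemma exact_parity_cochain:
  fixes \<phi> :: "'d::finite \<Rightarrow> ('d \<Rightarrow> int) \<Rightarrow> bool"
  assumes square: "\<And>i j x. i \<noteq> j \<Longrightarrow> x \<in> int_box lo hi \<Longrightarrow> step_up i x \<in> int_box lo hi \<Longrightarrow>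
      step_up j x \<in> int_box lo hi \<Longrightarrow> (\<phi> i x \<noteq> \<phi> j (step_up i x)) = (\<phi> j x \<noteq> \<phi> i (step_up j x))"
  shows "\<exists>g :: ('d \<Rightarrow> int) \<Rightarrow> bool. \<forall>i. \<forall>x\<in>int_box lo hi. step_up i x \<in> int_box lo hi \<longrightarrow> \<phi> i x = (g x \<noteq> g (step_up i x))"
proof -
  have "\<exists>g :: ('d \<Rightarrow> int) \<Rightarrow> bool. \<forall>i\<in>I. \<forall>x\<in>int_box lo hi. step_up i x \<in> int_box lo hi \<longrightarrow> \<phi> i x = (g x \<noteq> g (step_up i x))" for I
    using finite[of I]
  proof (induction I rule: finite_induct)
    case empty
    then show ?case by simp
  next
    case (insert j I)
    then obtain g :: "('d \<Rightarrow> int) \<Rightarrow> bool" where g: "\<And>i x. i \<in> I \<Longrightarrow> x \<in> int_box lo hi \<Longrightarrow> step_up i x \<in> int_box lo hi \<Longrightarrow>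
        \<phi> i x = (g x \<noteq> g (step_up i x))" by auto
    define h where "h x = (g (x(j := lo j)) \<noteq> odd (card {c \<in> {lo j..<x j}. \<phi> j (x(j := c))}))" for x
    have h_j: "\<phi> j x = (h x \<noteq> h (step_up j x))" if x: "x \<in> int_box lo hi" for x
    proof -
      have "lo j \<le> x j" using x by (auto simp: int_box_def)
      define A where "A = {c \<in> {lo j..<x j}. \<phi> j (x(j := c))}"
      have "{c \<in> {lo j..<step_up j x j}. \<phi> j ((step_up j x)(j := c))} =
          (if \<phi> j x then insert (x j) A else A)"
        using \<open>lo j \<le> x j\<close> by (auto simp: step_up_def less_le A_def)
      moreover have "finite A" unfolding A_def by (rule finite_subset[OF _ finite_atLeastLessThan_int]) auto
      moreover have "x j \<notin> A" by (simp add: A_def)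
      moreover have "(step_up j x)(j := lo j) = x(j := lo j)" by (simp add: step_up_def)
      ultimately show ?thesis unfolding h_def A_def[symmetric] by auto
    qed
    \<comment> \<open>The old directions stay correct: the squares carry the identity from one layer to the next.\<close>
    have h_I: "\<phi> i x = (h x \<noteq> h (step_up i x))"
      if "i \<in> I" "x \<in> int_box lo hi" "step_up i x \<in> int_box lo hi" for i x
      using that(2,3)
    proof (induction x rule: step_up_induct[where j = j])
      case (base x)
      have ij: "i \<noteq> j" using insert that by auto
      have "h y = g y" if y: "y j = lo j" for y
      proof -
        have "y(j := lo j) = y" using y by auto
        then show ?thesis by (simp add: h_def y)
      qed
      then have "h x = g x" "h (step_up i x) = g (step_up i x)"
        using base ij by (auto simp: step_up_def)
      then show ?case using g[OF that(1) base(1,3)] by simp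
    next
      case (step x)
      have ij: "i \<noteq> j" using insert that by auto
      have ix: "step_up i x \<in> int_box lo hi"
        using step.prems step.hyps ij by (auto simp: int_box_def step_up_def split: if_splits)
      have "h (step_up i (step_up j x)) = h (step_up j (step_up i x))" using ij by (simp add: step_up_commute)
      then show ?case
        using square[OF ij step.hyps(1) ix step.hyps(2)] step.IH[OF ix] h_j[OF step.hyps(1)] h_j[OF ix]
        by auto
    qed
    show ?case using h_j h_I by (intro exI[of _ h]) auto
  qed
  from this[of UNIV] show ?thesis by simp
qed

section \<open>The edges of a box in integer coordinates\<close>

definition lattice_point :: "('d \<Rightarrow> int) \<Rightarrow> real ^ 'd" where
  "lattice_point x = (\<chi> i. of_int (x i))"

abbreviation grid :: "nat \<Rightarrow> ('d \<Rightarrow> int) set" where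
  "grid m \<equiv> int_box (\<lambda>_. - int m) (\<lambda>_. int m)"

lemma lattice_point_nth [simp]: "lattice_point x $ i = of_int (x i)"
  by (simp add: lattice_point_def)

lemma inj_lattice_point: "inj lattice_point"
  by (auto simp: inj_def vec_eq_iff fun_eq_iff)

lemma lattice_point_eq_iff [simp]: "lattice_point x = lattice_point y \<longleftrightarrow> x = y"
  using inj_lattice_point by (auto dest: injD)

lemma lattice_eq_range: "lattice = range lattice_point"
proof -
  have "x \<in> range lattice_point" if "x \<in> lattice" for x :: "real ^ 'a"
  proof (rule range_eqI)
    show "x = lattice_point (\<lambda>i. \<lfloor>x $ i\<rfloor>)"
      using that by (auto simp: lattice_def vec_eq_iff elim!: Ints_cases)
  qed
  then show ?thesis by (auto simp: lattice_def)
qed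

lemma lattice_point_in_Box_iff: "lattice_point x \<in> Box m \<longleftrightarrow> x \<in> grid m"
proof -
  have "- real m \<le> of_int c \<longleftrightarrow> - int m \<le> c" "of_int c \<le> real m \<longleftrightarrow> c \<le> int m" for c
    by linarith+
  then show ?thesis by (simp add: Box_def mem_box_cart int_box_def)
qed

lemma lattice_Int_Box: "lattice \<inter> Box m = lattice_point ` grid m"
  by (auto simp: lattice_eq_range lattice_point_in_Box_iff)

lemma dist_lattice_point: "(dist (lattice_point x) (lattice_point y))\<^sup>2 = of_int (\<Sum>i\<in>UNIV. (x i - y i)\<^sup>2)"
  by (simp add: dist_norm norm_vec_def L2_set_def sum_nonneg)

text \<open>The squared distance is a sum of squares of integers, so at most one of them is nonzero, and it is 1.\<close>
lemma dist_lattice_point_le_1_iff: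
  fixes x y :: "'d::finite \<Rightarrow> int"
  shows "dist (lattice_point x) (lattice_point y) \<le> 1 \<longleftrightarrow> x = y \<or> (\<exists>i. y = step_up i x \<or> x = step_up i y)"
    (is "?L \<longleftrightarrow> ?R")
proof
  assume ?L
  then have "(dist (lattice_point x) (lattice_point y))\<^sup>2 \<le> 1"
    by (simp add: power_le_one_iff)
  then have le: "(\<Sum>i\<in>UNIV. (x i - y i)\<^sup>2) \<le> 1"
    unfolding dist_lattice_point by linarith
  show ?R
  proof (cases "x = y")
    case False
    then obtain i where i: "x i \<noteq> y i" by auto
    then have "(x i - y i)\<^sup>2 > 0" by simp
    moreover have "(\<Sum>j\<in>UNIV. (x j - y j)\<^sup>2) = (x i - y i)\<^sup>2 + (\<Sum>j\<in>UNIV - {i}. (x j - y j)\<^sup>2)"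
      by (rule sum.remove) auto
    moreover have nn: "0 \<le> (\<Sum>j\<in>UNIV - {i}. (x j - y j)\<^sup>2)" by (rule sum_nonneg) auto
    ultimately have 1: "(x i - y i)\<^sup>2 = 1" and "(\<Sum>j\<in>UNIV - {i}. (x j - y j)\<^sup>2) = 0" using le by linarith+
    then have "x j = y j" if "j \<noteq> i" for j using that by (simp add: sum_nonneg_eq_0_iff)
    moreover have "y i = x i + 1 \<or> x i = y i + 1" using 1 by (auto simp: power2_eq_1_iff)
    ultimately have "y = step_up i x \<or> x = step_up i y" by (auto simp: step_up_def fun_eq_iff)
    then show ?thesis by blast
  qed simp
next
  have "dist (lattice_point x) (lattice_point (step_up i x)) = 1" for i and x :: "'d \<Rightarrow> int"
  proof -
    have "(\<Sum>j\<in>UNIV. (x j - step_up i x j)\<^sup>2) = (\<Sum>j\<in>UNIV. if j = i then 1 else 0)"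
      by (rule sum.cong) (auto simp: step_up_def)
    then have "(dist (lattice_point x) (lattice_point (step_up i x)))\<^sup>2 = 1"
      unfolding dist_lattice_point by simp
    then show ?thesis by (smt (verit) power2_eq_1_iff zero_le_dist)
  qed
  then show "?R \<Longrightarrow> ?L" by (auto simp: dist_commute)
qed

lemma dist_lattice_point_eq_1_iff:
  fixes x y :: "'d::finite \<Rightarrow> int"
  shows "dist (lattice_point x) (lattice_point y) = 1 \<longleftrightarrow> (\<exists>i. y = step_up i x \<or> x = step_up i y)"
    (is "?L \<longleftrightarrow> ?R")
proof
  show ?R if ?L using dist_lattice_point_le_1_iff[of x y] that by auto
next
  assume R: ?R
  then have "x \<noteq> y" by (auto simp: step_up_def fun_eq_iff)
  then have "(\<Sum>i\<in>UNIV. (x i - y i)\<^sup>2) \<noteq> 0"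
    by (simp add: sum_nonneg_eq_0_iff fun_eq_iff)
  moreover have "(\<Sum>i\<in>UNIV. (x i - y i)\<^sup>2) \<ge> 0" by (rule sum_nonneg) auto
  ultimately have "(\<Sum>i\<in>UNIV. (x i - y i)\<^sup>2) \<ge> 1" by linarith
  then have "(dist (lattice_point x) (lattice_point y))\<^sup>2 \<ge> 1" unfolding dist_lattice_point by linarith
  then have "dist (lattice_point x) (lattice_point y) \<ge> 1"
    by (smt (verit) power_le_one_iff zero_le_dist power2_eq_1_iff)
  then show ?L using R dist_lattice_point_le_1_iff[of x y] by (auto intro: antisym)
qed

lemma pair_in_box_edges_iff:
  "{x, y} \<in> box_edges m \<longleftrightarrow> x \<in> lattice \<inter> Box m \<and> y \<in> lattice \<inter> Box m \<and> dist x y = 1"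
proof -
  have "convex hull {x, y} \<subseteq> Box m \<longleftrightarrow> x \<in> Box m \<and> y \<in> Box m"
    unfolding Box_def by (meson bot_least convex_box(1) hull_minimal hull_subset insert_subset order_trans)
  moreover have "{x, y} \<in> lattice_edges \<longleftrightarrow> x \<in> lattice \<and> y \<in> lattice \<and> dist x y = 1"
    unfolding lattice_edges_def by (auto simp: doubleton_eq_iff dist_commute)
  ultimately show ?thesis by (auto simp: box_edges_def)
qed

lemma box_edgeE:
  assumes "e \<in> box_edges m"
  obtains x i where "e = {lattice_point x, lattice_point (step_up i x)}" "x \<in> grid m" "step_up i x \<in> grid m"
proof -
  obtain a b where e: "e = {a, b}" using assms by (auto simp: box_edges_def lattice_edges_def)
  then have "a \<in> lattice_point ` grid m" "b \<in> lattice_point ` grid m" "dist a b = 1"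
    using assms by (auto simp: pair_in_box_edges_iff lattice_Int_Box)
  then obtain x y where xy: "a = lattice_point x" "b = lattice_point y" "x \<in> grid m" "y \<in> grid m"
    and "dist (lattice_point x) (lattice_point y) = 1" by auto
  then obtain i where "y = step_up i x \<or> x = step_up i y" by (auto simp: dist_lattice_point_eq_1_iff)
  then show ?thesis
  proof
    assume "y = step_up i x"
    then show ?thesis using that[of x i] e xy by simp
  next
    assume "x = step_up i y"
    then show ?thesis using that[of y i] e xy by (simp add: insert_commute)
  qed
qed

lemma lattice_point_edge_iff:
  "{lattice_point x, lattice_point y} \<in> box_edges m \<longleftrightarrow>
    x \<in> grid m \<and> y \<in> grid m \<and> (\<exists>i. y = step_up i x \<or> x = step_up i y)"
  by (auto simp: pair_in_box_edges_iff lattice_Int_Box dist_lattice_point_eq_1_iff)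

lemma finite_grid: "finite (grid m :: ('d::finite \<Rightarrow> int) set)"
proof -
  have "grid m = (UNIV :: 'd set) \<rightarrow>\<^sub>E {- int m..int m}"
    by (auto simp: int_box_def PiE_def Pi_def)
  then show ?thesis by (simp add: finite_PiE)
qed

lemma finite_lattice_Int_Box: "finite (lattice \<inter> Box m :: (real ^ 'd::finite) set)"
  by (simp add: lattice_Int_Box finite_grid)

lemma box_edges_subset_Pow: "box_edges m \<subseteq> Pow (lattice \<inter> Box m)"
  by (auto elim!: box_edgeE simp: lattice_Int_Box)

lemma finite_box_edges [simp]: "finite (box_edges m :: 'd::finite edge set)"
  using box_edges_subset_Pow finite_lattice_Int_Box by (meson finite_Pow_iff finite_subset)

text \<open>Every lattice point of the box lies on an edge, and an edge has two endpoints. This compares the allowed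
  length \<open>s\<close> of the time window with the number of edges.\<close>
lemma card_lattice_Int_Box_le:
  assumes "m > 0"
  shows "card (Box m \<inter> lattice :: (real ^ 'd::finite) set) \<le> 2 * card (box_edges m :: 'd edge set)"
proof -
  have "Box m \<inter> lattice \<subseteq> \<Union>(box_edges m :: 'd edge set)"
  proof
    fix a :: "real ^ 'd" assume "a \<in> Box m \<inter> lattice"
    then obtain x where x: "a = lattice_point x" "x \<in> grid m" using lattice_Int_Box by blast
    define i :: 'd where "i = undefined"
    \<comment> \<open>a neighbour of \<open>x\<close> that does not leave the box\<close>
    define y where "y = (if x i < int m then step_up i x else x(i := x i - 1))"
    have "y \<in> grid m" using x(2) assms by (auto simp: y_def int_box_def step_up_def) (smt (verit))+
    moreover have "y = step_up i x \<or> x = step_up i y" by (auto simp: y_def step_up_def)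
    ultimately have "{lattice_point x, lattice_point y} \<in> box_edges m"
      using x(2) by (auto simp: lattice_point_edge_iff)
    then show "a \<in> \<Union>(box_edges m)" using x by auto
  qed
  then have "card (Box m \<inter> lattice :: (real ^ 'd::finite) set) \<le> card (\<Union>(box_edges m :: 'd edge set))"
    by (rule card_mono[rotated])
       (meson Pow_iff Sup_le_iff box_edges_subset_Pow finite_lattice_Int_Box finite_subset subsetD)
  also have "\<dots> \<le> (\<Sum>e\<in>(box_edges m :: 'd edge set). card e)"
    by (rule card_Union_le_sum_card)
  also have "\<dots> \<le> (\<Sum>e\<in>(box_edges m :: 'd edge set). 2)"
    by (rule sum_mono) (auto elim!: box_edgeE simp: card_insert_if)
  finally show ?thesis by simp
qed

section \<open>Separating sets of edges\<close>

definition edge_rel :: "'a set set \<Rightarrow> ('a \<times> 'a) set" where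
  "edge_rel G = {(x, y). {x, y} \<in> G}"

text \<open>The relation is chosen such that any two edges of a unit square are adjacent, including opposite ones.\<close>
definition adjacent :: "'d::finite edge \<Rightarrow> 'd edge \<Rightarrow> bool" where
  "adjacent e f \<longleftrightarrow> (\<exists>x\<in>e. \<exists>y\<in>f. dist x y \<le> 1)"

lemma path_edges_Cons_Cons: "path_edges (x # y # xs) = insert {x, y} (path_edges (y # xs))"
  by (auto simp: path_edges_def)

lemma path_edges_singleton: "path_edges [x] = {}"
  by (auto simp: path_edges_def)

lemma rtrancl_edge_rel_of_path:
  "xs \<noteq> [] \<Longrightarrow> path_edges xs \<subseteq> G \<Longrightarrow> (hd xs, last xs) \<in> (edge_rel G)\<^sup>*"
proof (induction xs rule: induct_list012)
  case (3 x y zs)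
  then have "(x, y) \<in> edge_rel G" by (auto simp: path_edges_Cons_Cons edge_rel_def)
  then show ?case using 3 by (auto simp: path_edges_Cons_Cons intro: converse_rtrancl_into_rtrancl)
qed auto

lemma path_of_rtrancl_edge_rel:
  assumes "(x, y) \<in> (edge_rel G)\<^sup>*" "y \<in> lattice" "G \<subseteq> box_edges m"
  shows "\<exists>xs. xs \<noteq> [] \<and> hd xs = x \<and> last xs = y \<and> set xs \<subseteq> lattice \<and> path_edges xs \<subseteq> G"
  using assms(1)
proof (induction rule: converse_rtrancl_induct)
  case base
  show ?case using assms(2) by (intro exI[of _ "[y]"]) (auto simp: path_edges_singleton)
next
  case (step x z)
  then obtain xs where xs: "xs \<noteq> []" "hd xs = z" "last xs = y" "set xs \<subseteq> lattice" "path_edges xs \<subseteq> G"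
    by blast
  have "{x, z} \<in> G" using step by (simp add: edge_rel_def)
  moreover from this have "x \<in> lattice" using assms(3) by (auto simp: pair_in_box_edges_iff)
  ultimately show ?case using xs by (cases xs; intro exI[of _ "x # xs"]) (auto simp: path_edges_Cons_Cons)
qed

lemma crossing_path_within_iff:
  assumes "G \<subseteq> box_edges m"
  shows "(\<exists>xs. crossing_path k m xs \<and> path_edges xs \<subseteq> G) \<longleftrightarrow>
    (\<exists>x\<in>top_side k m \<inter> lattice. \<exists>y\<in>bottom_side k m \<inter> lattice. (x, y) \<in> (edge_rel G)\<^sup>*)"
proof
  assume "\<exists>xs. crossing_path k m xs \<and> path_edges xs \<subseteq> G"
  then obtain xs where xs: "crossing_path k m xs" "path_edges xs \<subseteq> G" by blast
  then have "xs \<noteq> []" "set xs \<subseteq> lattice" by (auto simp: crossing_path_def)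
  then have "hd xs \<in> lattice" "last xs \<in> lattice" by auto
  then show "\<exists>x\<in>top_side k m \<inter> lattice. \<exists>y\<in>bottom_side k m \<inter> lattice. (x, y) \<in> (edge_rel G)\<^sup>*"
    using xs rtrancl_edge_rel_of_path[of xs G] by (auto simp: crossing_path_def)
next
  assume "\<exists>x\<in>top_side k m \<inter> lattice. \<exists>y\<in>bottom_side k m \<inter> lattice. (x, y) \<in> (edge_rel G)\<^sup>*"
  then obtain x y where "x \<in> top_side k m \<inter> lattice" "y \<in> bottom_side k m \<inter> lattice"
      "(x, y) \<in> (edge_rel G)\<^sup>*" by blast
  with path_of_rtrancl_edge_rel[of x y G m] show "\<exists>xs. crossing_path k m xs \<and> path_edges xs \<subseteq> G"
    using assms by (fastforce simp: crossing_path_def)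
qed

lemma separates_iff:
  "separates k m S \<longleftrightarrow> S \<subseteq> box_edges m \<and>
    \<not> (\<exists>x\<in>top_side k m \<inter> lattice. \<exists>y\<in>bottom_side k m \<inter> lattice. (x, y) \<in> (edge_rel (box_edges m - S))\<^sup>*)"
proof -
  have "separates k m S \<longleftrightarrow> S \<subseteq> box_edges m \<and> \<not> (\<exists>xs. crossing_path k m xs \<and> path_edges xs \<subseteq> box_edges m - S)"
    by (auto simp: separates_def crossing_path_def)
  then show ?thesis by (simp add: crossing_path_within_iff)
qed

definition closed_edges :: "nat \<Rightarrow> 'd::finite config \<Rightarrow> 'd edge set" where
  "closed_edges m \<eta> = {e \<in> box_edges m. \<not> \<eta> e}"

lemma not_connected_iff_separates: "\<not> top_bottom_connected k m \<eta> \<longleftrightarrow> separates k m (closed_edges m \<eta>)"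
  by (auto simp: top_bottom_connected_def separates_def closed_edges_def crossing_path_def)

lemma separates_mono: "separates k m S \<Longrightarrow> S \<subseteq> S' \<Longrightarrow> S' \<subseteq> box_edges m \<Longrightarrow> separates k m S'"
  by (fastforce simp: separates_def)

lemma pivotal_in_closed_separating_set:
  assumes "f \<in> pivotal k m \<eta>" "separates k m S" "S \<subseteq> closed_edges m \<eta>"
  shows "f \<in> S"
proof -
  obtain xs where xs: "crossing_path k m xs" "\<And>e. e \<in> path_edges xs \<Longrightarrow> (\<eta>(f := True)) e"
    using assms(1) by (auto simp: pivotal_def top_bottom_connected_def)
  then obtain e where e: "e \<in> path_edges xs" "e \<in> S" using assms(2) unfolding separates_def by blast
  then have "\<not> \<eta> e" using assms(3) by (auto simp: closed_edges_def)
  then show ?thesis using xs(2)[OF e(1)] e(2) by (cases "e = f") auto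
qed

lemma rtrancl_invariant:
  assumes "(x, y) \<in> R\<^sup>*" "\<And>a b. (a, b) \<in> R \<Longrightarrow> h a = h b"
  shows "h x = h y"
  using assms by (induction rule: rtrancl_induct) auto

text \<open>Let \<open>U\<close> be the set reached from the top without crossing \<open>D\<^sub>1 \<union> D\<^sub>2\<close>, and \<open>S\<close> its edge boundary. A unit square
  meets \<open>S\<close> in an even number of edges, and it cannot meet both \<open>D\<^sub>1\<close> and \<open>D\<^sub>2\<close>, so it also meets \<open>S \<inter> D\<^sub>1\<close> in
  an even number of edges. Thus \<open>S \<inter> D\<^sub>1\<close> is the boundary of a set \<open>{x. h x}\<close>, and \<open>S \<inter> D\<^sub>2\<close> that of its symmetric
  difference with \<open>U\<close>. Both sets contain all or nothing of the top, and all or nothing of the bottom. A crossing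
  that avoids \<open>D\<^sub>1\<close> shows that \<open>h\<close> has the same value on top and bottom, and a crossing that avoids \<open>D\<^sub>2\<close> shows
  the same for the symmetric difference; this is impossible, as \<open>U\<close> contains the top and misses the bottom.\<close>
lemma separating_union:
  fixes D\<^sub>1 D\<^sub>2 :: "'d::finite edge set"
  assumes sep: "separates k m (D\<^sub>1 \<union> D\<^sub>2)"
    and apart: "\<And>e f. e \<in> D\<^sub>1 \<Longrightarrow> f \<in> D\<^sub>2 \<Longrightarrow> \<not> adjacent e f"
  shows "separates k m D\<^sub>1 \<or> separates k m D\<^sub>2"
proof (rule ccontr)
  assume contra: "\<not> ?thesis"
  let ?T = "top_side k m \<inter> lattice" and ?B = "bottom_side k m \<inter> lattice"
  let ?R = "\<lambda>S. edge_rel (box_edges m - S)"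
  have D_box: "D\<^sub>1 \<subseteq> box_edges m" "D\<^sub>2 \<subseteq> box_edges m" using sep by (auto simp: separates_def)
  obtain x\<^sub>1 y\<^sub>1 where 1: "x\<^sub>1 \<in> ?T" "y\<^sub>1 \<in> ?B" "(x\<^sub>1, y\<^sub>1) \<in> (?R D\<^sub>1)\<^sup>*"
    using contra D_box by (auto simp: separates_iff)
  obtain x\<^sub>2 y\<^sub>2 where 2: "x\<^sub>2 \<in> ?T" "y\<^sub>2 \<in> ?B" "(x\<^sub>2, y\<^sub>2) \<in> (?R D\<^sub>2)\<^sup>*"
    using contra D_box by (auto simp: separates_iff)
  define U where "U = {y. \<exists>x\<in>?T. (x, y) \<in> (?R (D\<^sub>1 \<union> D\<^sub>2))\<^sup>*}"
  have TU: "?T \<subseteq> U" by (auto simp: U_def)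
  have BU: "?B \<inter> U = {}" using sep by (auto simp: U_def separates_iff)
  have U_closed: "{x, y} \<in> D\<^sub>1 \<union> D\<^sub>2" if "{x, y} \<in> box_edges m" "x \<in> U" "y \<notin> U" for x y
  proof (rule ccontr)
    assume "{x, y} \<notin> D\<^sub>1 \<union> D\<^sub>2"
    then have "(x, y) \<in> ?R (D\<^sub>1 \<union> D\<^sub>2)" using that by (simp add: edge_rel_def)
    then have "y \<in> U" using that(2) by (auto simp: U_def intro: rtrancl_into_rtrancl)
    then show False using that by simp
  qed
  define S where "S = {e \<in> box_edges m. \<exists>x y. e = {x, y} \<and> x \<in> U \<and> y \<notin> U}"
  have S_iff: "{x, y} \<in> S \<longleftrightarrow> (x \<in> U) \<noteq> (y \<in> U)" if "{x, y} \<in> box_edges m" for x y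
    using that by (auto simp: S_def doubleton_eq_iff)
  have SD: "S \<subseteq> D\<^sub>1 \<union> D\<^sub>2" using U_closed by (auto simp: S_def)
  define \<phi> where "\<phi> i x \<longleftrightarrow> {lattice_point x, lattice_point (step_up i x)} \<in> S \<inter> D\<^sub>1" for i x
  have "\<exists>g :: ('d \<Rightarrow> int) \<Rightarrow> bool. \<forall>i. \<forall>x\<in>grid m. step_up i x \<in> grid m \<longrightarrow> \<phi> i x = (g x \<noteq> g (step_up i x))"
  proof (rule exact_parity_cochain)
    fix i j and x :: "'d \<Rightarrow> int"
    assume ij: "i \<noteq> j" and x: "x \<in> grid m" "step_up i x \<in> grid m" "step_up j x \<in> grid m"
    define a b c d where "a = lattice_point x" and "b = lattice_point (step_up i x)"
      and "c = lattice_point (step_up j x)" and "d = lattice_point (step_up j (step_up i x))"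
    have d': "d = lattice_point (step_up i (step_up j x))" using ij by (simp add: d_def step_up_commute)
    have w: "step_up j (step_up i x) \<in> grid m"
      using x ij by (auto simp: int_box_def step_up_def split: if_splits)
    have box: "{a, b} \<in> box_edges m" "{b, d} \<in> box_edges m" "{a, c} \<in> box_edges m" "{c, d} \<in> box_edges m"
      using x w by (auto simp: a_def b_def c_def d_def lattice_point_edge_iff ij step_up_commute)
         (metis ij step_up_commute)
    then have dist: "dist a b = 1" "dist b d = 1" "dist a c = 1" "dist c d = 1"
      by (auto simp: pair_in_box_edges_iff)
    define Q where "Q = {{a, b}, {b, d}, {a, c}, {c, d}}"
    have adj: "adjacent e f" if "e \<in> Q" "f \<in> Q" for e f
      using that dist by (auto simp: Q_def adjacent_def dist_commute)
    have "(({a, b} \<in> S \<inter> D\<^sub>1) \<noteq> ({b, d} \<in> S \<inter> D\<^sub>1)) = (({a, c} \<in> S \<inter> D\<^sub>1) \<noteq> ({c, d} \<in> S \<inter> D\<^sub>1))"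
    proof (cases "Q \<inter> D\<^sub>1 = {}")
      case True
      then show ?thesis by (auto simp: Q_def)
    next
      case False
      then have "Q \<inter> D\<^sub>2 = {}" using adj apart by blast
      then have "e \<in> S \<inter> D\<^sub>1 \<longleftrightarrow> e \<in> S" if "e \<in> Q" for e using that SD by blast
      then show ?thesis using S_iff[OF box(1)] S_iff[OF box(2)] S_iff[OF box(3)] S_iff[OF box(4)]
        by (simp add: Q_def) blast
    qed
    then show "(\<phi> i x \<noteq> \<phi> j (step_up i x)) = (\<phi> j x \<noteq> \<phi> i (step_up j x))"
      unfolding \<phi>_def d'[symmetric] a_def[symmetric] b_def[symmetric] c_def[symmetric] d_def[symmetric] .
  qed
  then obtain g :: "('d \<Rightarrow> int) \<Rightarrow> bool" where
    g: "\<And>i x. x \<in> grid m \<Longrightarrow> step_up i x \<in> grid m \<Longrightarrow> \<phi> i x = (g x \<noteq> g (step_up i x))" by blast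
  define h where "h a = g (inv lattice_point a)" for a
  have h_lp [simp]: "h (lattice_point x) = g x" for x
    by (simp add: h_def inj_lattice_point)
  have h: "{a, b} \<in> S \<inter> D\<^sub>1 \<longleftrightarrow> h a \<noteq> h b" if "{a, b} \<in> box_edges m" for a b
  proof -
    obtain x i where xi: "{a, b} = {lattice_point x, lattice_point (step_up i x)}" "x \<in> grid m" "step_up i x \<in> grid m"
      using \<open>{a, b} \<in> box_edges m\<close> by (rule box_edgeE)
    have "{a, b} \<in> S \<inter> D\<^sub>1 \<longleftrightarrow> g x \<noteq> g (step_up i x)"
      unfolding xi(1) using g[OF xi(2,3)] by (simp add: \<phi>_def)
    also have "\<dots> \<longleftrightarrow> h a \<noteq> h b" using xi(1) by (auto simp: doubleton_eq_iff)
    finally show ?thesis .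
  qed
  \<comment> \<open>\<open>h\<close> is constant on a horizontal slice of the box on which membership in \<open>U\<close> does not vary\<close>
  have const: "h a = h b" if ab: "a \<in> A" "b \<in> A" and A: "A = {x \<in> Box m. x $ k = of_int c} \<inter> lattice"
    and c: "- int m \<le> c" "c \<le> int m" and U: "A \<subseteq> U \<or> A \<inter> U = {}" for A a b c
  proof -
    let ?lo = "\<lambda>i. if i = k then c else - int m" and ?hi = "\<lambda>i. if i = k then c else int m"
    have slice: "int_box ?lo ?hi = {x \<in> grid m. x k = c}"
    proof (intro set_eqI iffI)
      fix x assume "x \<in> int_box ?lo ?hi"
      then have b: "?lo i \<le> x i \<and> x i \<le> ?hi i" for i unfolding int_box_def by blast
      have "x k = c" using b[of k] by simp
      moreover have "- int m \<le> x i \<and> x i \<le> int m" for i using b[of i] c by (cases "i = k") auto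
      ultimately show "x \<in> {x \<in> grid m. x k = c}" by (simp add: int_box_def)
    qed (auto simp: int_box_def)
    have A_eq: "A = lattice_point ` int_box ?lo ?hi"
    proof -
      have "A = {y \<in> lattice \<inter> Box m. y $ k = of_int c}" using A by auto
      then show ?thesis unfolding slice lattice_Int_Box by auto
    qed
    have sub: "int_box ?lo ?hi \<subseteq> grid m" unfolding slice by blast
    have "g (step_up i x) = g x" if "x \<in> int_box ?lo ?hi" "step_up i x \<in> int_box ?lo ?hi" for i x
    proof -
      have "x \<in> grid m" "step_up i x \<in> grid m" using that sub by blast+
      then have box: "{lattice_point x, lattice_point (step_up i x)} \<in> box_edges m"
        unfolding lattice_point_edge_iff by blast
      have "lattice_point x \<in> A" "lattice_point (step_up i x) \<in> A" unfolding A_eq using that by blast+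
      then have "lattice_point x \<in> U \<longleftrightarrow> lattice_point (step_up i x) \<in> U" using U by blast
      then have "{lattice_point x, lattice_point (step_up i x)} \<notin> S" using S_iff[OF box] by blast
      then have "\<not> \<phi> i x" unfolding \<phi>_def by blast
      then show ?thesis using g[OF \<open>x \<in> grid m\<close> \<open>step_up i x \<in> grid m\<close>] by blast
    qed
    note g_const = constant_on_int_box[of ?lo ?hi g, OF this]
    obtain u where u: "a = lattice_point u" "u \<in> int_box ?lo ?hi"
      using ab(1) unfolding A_eq by (rule imageE)
    obtain v where v: "b = lattice_point v" "v \<in> int_box ?lo ?hi"
      using ab(2) unfolding A_eq by (rule imageE)
    have "g u = g v" by (rule g_const[OF _ _ u(2) v(2)])
    then show ?thesis unfolding u(1) v(1) h_lp .
  qed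
  have hT: "h x\<^sub>1 = h x\<^sub>2"
    using 1(1) 2(1) TU by (intro const[of _ ?T _ "int m"]) (auto simp: top_side_def)
  have hB: "h y\<^sub>1 = h y\<^sub>2"
    using 1(2) 2(2) BU by (intro const[of _ ?B _ "- int m"]) (auto simp: bottom_side_def)
  have "h x\<^sub>1 = h y\<^sub>1"
    using 1(3) by (rule rtrancl_invariant) (use h in \<open>auto simp: edge_rel_def\<close>)
  moreover have "(h x\<^sub>2 = (x\<^sub>2 \<in> U)) = (h y\<^sub>2 = (y\<^sub>2 \<in> U))"
    using 2(3)
  proof (rule rtrancl_invariant)
    fix a b assume "(a, b) \<in> ?R D\<^sub>2"
    then have ab: "{a, b} \<in> box_edges m" "{a, b} \<notin> D\<^sub>2" by (auto simp: edge_rel_def)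
    then have "{a, b} \<in> S \<inter> D\<^sub>1 \<longleftrightarrow> {a, b} \<in> S" using SD by blast
    then show "(h a = (a \<in> U)) = (h b = (b \<in> U))" using h[OF ab(1)] S_iff[OF ab(1)] by auto
  qed
  moreover have "x\<^sub>2 \<in> U" "y\<^sub>2 \<notin> U" using TU BU 2 by auto
  ultimately show False using hT hB by auto
qed

section \<open>Chains of adjacent edges\<close>

text \<open>\<open>D r\<close> is the set of closed edges at time \<open>r\<close>, and the assumption \<open>meet\<close> expresses that there is a pivotal
  edge. Two disjoint separating sets of closed edges cannot coexist at such a time. So when an
  edge opens, separation cannot pass from the part outside \<open>K\<close> to the part inside \<open>K\<close>.\<close>
lemma separating_set_stays_outside:
  fixes D :: "nat \<Rightarrow> 'd::finite edge set"
  assumes D_sub: "\<And>r. r \<le> s \<Longrightarrow> D r \<subseteq> bad"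
    and sep: "\<And>r. r \<le> s \<Longrightarrow> separates k m (D r)"
    and step: "\<And>r. r < s \<Longrightarrow> D (Suc r) \<subseteq> D r \<or> D r \<subseteq> D (Suc r)"
    and meet: "\<And>r. r < s \<Longrightarrow> \<exists>f. \<forall>S\<subseteq>D r. separates k m S \<longrightarrow> f \<in> S"
    and isolated: "\<And>f f'. f \<in> K \<Longrightarrow> f' \<in> bad - K \<Longrightarrow> \<not> adjacent f f'"
    and start: "separates k m (D 0 - K)"
  shows "r \<le> s \<Longrightarrow> separates k m (D r - K)"
proof (induction r)
  case 0
  show ?case by (rule start)
next
  case (Suc r)
  have box: "D (Suc r) \<subseteq> box_edges m" using sep[OF Suc.prems] by (simp add: separates_def)
  have IH: "separates k m (D r - K)" using Suc by simp
  show ?case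
  proof (cases "D r \<subseteq> D (Suc r)")
    case True
    show ?thesis by (rule separates_mono[OF IH]) (use True box in auto)
  next
    case False
    then have sub: "D (Suc r) \<subseteq> D r" using step[of r] Suc.prems by auto
    have "separates k m (D (Suc r) \<inter> K) \<or> separates k m (D (Suc r) - K)"
    proof (rule separating_union)
      show "separates k m (D (Suc r) \<inter> K \<union> (D (Suc r) - K))"
        using sep[OF Suc.prems] by (simp add: Int_Diff_Un)
    qed (use D_sub[OF Suc.prems] isolated in blast)
    moreover have "\<not> separates k m (D (Suc r) \<inter> K)"
    proof
      assume *: "separates k m (D (Suc r) \<inter> K)"
      obtain f where f: "\<And>S. S \<subseteq> D r \<Longrightarrow> separates k m S \<Longrightarrow> f \<in> S"
        using meet[of r] Suc.prems by auto
      have "f \<in> D (Suc r) \<inter> K" by (rule f[OF _ *]) (use sub in auto)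
      moreover have "f \<in> D r - K" by (rule f[OF _ IH]) auto
      ultimately show False by simp
    qed
    ultimately show ?thesis by simp
  qed
qed

text \<open>The index counts steps, so these lists have one more edge than the index.\<close>
fun chains :: "nat \<Rightarrow> nat \<Rightarrow> 'd::finite edge \<Rightarrow> 'd edge list set" where
  "chains m 0 e = {[e]}"
| "chains m (Suc n) e = (\<Union>f\<in>{f \<in> box_edges m. adjacent e f}. (#) e ` chains m n f)"

lemma edge_dist_le_1: "e \<in> box_edges m \<Longrightarrow> x \<in> e \<Longrightarrow> y \<in> e \<Longrightarrow> dist x y \<le> 1"
  by (auto elim!: box_edgeE simp: dist_lattice_point_le_1_iff)

text \<open>The point is that the bound does not depend on the size of the box.\<close>
lemma card_adjacent_le:
  assumes e: "e \<in> box_edges m"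
  shows "card {f \<in> box_edges m. adjacent e (f :: 'd::finite edge)} \<le> 2 * (2 * CARD('d) + 1)\<^sup>2"
proof -
  define nb where "nb x = {y \<in> lattice. dist x y \<le> 1}" for x :: "real ^ 'd"
  have nb: "finite (nb x) \<and> card (nb x) \<le> 2 * CARD('d) + 1" if x: "x \<in> lattice" for x
  proof -
    obtain u where u: "x = lattice_point u" using x by (auto simp: lattice_eq_range)
    let ?V = "insert u (range (\<lambda>i. step_up i u) \<union> range (\<lambda>i. u(i := u i - 1)))"
    have "nb x \<subseteq> lattice_point ` ?V"
    proof
      fix y assume "y \<in> nb x"
      then obtain v where v: "y = lattice_point v" "dist (lattice_point u) (lattice_point v) \<le> 1"
        unfolding nb_def lattice_eq_range u by blast
      have "v = u(i := u i - 1)" if "u = step_up i v" for i using that by (simp add: step_up_def)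
      then have "v \<in> ?V" using v(2) unfolding dist_lattice_point_le_1_iff by blast
      then show "y \<in> lattice_point ` ?V" using v(1) by blast
    qed
    moreover have "finite ?V" by simp
    moreover have "card ?V \<le> 2 * CARD('d) + 1"
    proof -
      have "card ?V \<le> Suc (card (range (\<lambda>i. step_up i u) \<union> range (\<lambda>i. u(i := u i - 1))))"
        by (rule card_insert_le_m1) auto
      also have "\<dots> \<le> Suc (CARD('d) + CARD('d))"
        by (intro Suc_leI le_imp_less_Suc card_Un_le[THEN order_trans] add_mono card_image_le) auto
      finally show ?thesis by simp
    qed
    ultimately show ?thesis
      by (meson card_image_le card_mono finite_imageI finite_subset order_trans)
  qed
  obtain u v where uv: "e = {u, v}" using e by (auto elim: box_edgeE)
  have lat: "u \<in> lattice" "v \<in> lattice" using e uv by (auto simp: pair_in_box_edges_iff)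
  let ?F = "\<lambda>x. (\<lambda>(y, z). {y, z}) ` (SIGMA y:nb x. nb y)"
  have F: "finite (?F x) \<and> card (?F x) \<le> (2 * CARD('d) + 1)\<^sup>2" if x: "x \<in> lattice" for x
  proof -
    have y: "finite (nb y) \<and> card (nb y) \<le> 2 * CARD('d) + 1" if "y \<in> nb x" for y
      using nb that by (simp add: nb_def)
    have fin: "finite (SIGMA y:nb x. nb y)" using y nb[OF x] by auto
    have "card (?F x) \<le> card (SIGMA y:nb x. nb y)" by (rule card_image_le[OF fin])
    also have "\<dots> = (\<Sum>y\<in>nb x. card (nb y))" using y nb[OF x] by (intro card_SigmaI) auto
    also have "\<dots> \<le> (\<Sum>y\<in>nb x. 2 * CARD('d) + 1)" using y by (intro sum_mono) auto
    also have "\<dots> \<le> (2 * CARD('d) + 1)\<^sup>2"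
      unfolding sum_constant power2_eq_square of_nat_id by (intro mult_right_mono) (use nb[OF x] in auto)
    finally show ?thesis using fin by auto
  qed
  have "{f \<in> box_edges m. adjacent e f} \<subseteq> ?F u \<union> ?F v"
  proof
    fix f assume "f \<in> {f \<in> box_edges m. adjacent e f}"
    then obtain x y where f: "f \<in> box_edges m" and x: "x \<in> {u, v}" and y: "y \<in> f" "dist x y \<le> 1"
      by (auto simp: adjacent_def uv)
    obtain z where z: "f = {y, z}" using f y(1) by (auto elim!: box_edgeE)
    have "y \<in> nb x" "z \<in> nb y"
      using f y z edge_dist_le_1[OF f, of y z] by (auto simp: pair_in_box_edges_iff nb_def)
    then have "f \<in> ?F x" using z by (auto intro!: rev_image_eqI[of "(y, z)"])
    then show "f \<in> ?F u \<union> ?F v" using x by auto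
  qed
  then have "card {f \<in> box_edges m. adjacent e f} \<le> card (?F u \<union> ?F v)"
    using F lat by (intro card_mono) auto
  also have "\<dots> \<le> card (?F u) + card (?F v)" by (rule card_Un_le)
  also have "\<dots> \<le> 2 * (2 * CARD('d) + 1)\<^sup>2" using F lat by (auto simp: mult_2 intro: add_mono)
  finally show ?thesis .
qed

lemma card_chains_le:
  "e \<in> box_edges m \<Longrightarrow> finite (chains m n (e :: 'd::finite edge)) \<and>
    card (chains m n e) \<le> (2 * (2 * CARD('d) + 1)\<^sup>2) ^ n"
proof (induction n arbitrary: e)
  case (Suc n)
  let ?A = "{f \<in> box_edges m. adjacent e f}" and ?M = "2 * (2 * CARD('d) + 1)\<^sup>2"
  have "card (chains m (Suc n) e) \<le> (\<Sum>f\<in>?A. card ((#) e ` chains m n f))"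
    by (simp add: card_UN_le)
  also have "\<dots> \<le> (\<Sum>f\<in>?A. ?M ^ n)"
    using Suc.IH by (intro sum_mono order_trans[OF card_image_le]) auto
  also have "\<dots> \<le> ?M * ?M ^ n"
    using card_adjacent_le[OF Suc.prems] by (simp only: sum_constant of_nat_id mult_le_mono1)
  finally show ?case using Suc.IH by simp
qed simp

lemma chain_close:
  assumes "xs \<in> chains m n e" "e \<in> box_edges m" "f \<in> set xs"
  shows "f \<in> box_edges m \<and> (\<forall>x\<in>e. \<exists>y\<in>f. dist x y \<le> 2 * real n)"
  using assms
proof (induction n arbitrary: e xs)
  case (Suc n)
  obtain e' ys where ys: "e' \<in> box_edges m" "adjacent e e'" "ys \<in> chains m n e'" "xs = e # ys"
    using Suc.prems by auto
  show ?case
  proof (cases "f = e")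
    case True
    then show ?thesis using Suc.prems by force
  next
    case False
    then have f: "f \<in> set ys" using Suc.prems ys by simp
    obtain u v where uv: "u \<in> e" "v \<in> e'" "dist u v \<le> 1" using ys by (auto simp: adjacent_def)
    obtain y where "y \<in> f" "dist v y \<le> 2 * real n" using Suc.IH[OF ys(3,1) f] uv by auto
    have "dist x y \<le> 2 * real (Suc n)" if "x \<in> e" for x
    proof -
      have "dist x u \<le> 1" using edge_dist_le_1[OF Suc.prems(2) that uv(1)] .
      then show ?thesis using dist_triangle[of x y u] dist_triangle[of u y v] uv(3) \<open>dist v y \<le> 2 * real n\<close>
        by simp
    qed
    then show ?thesis using Suc.IH[OF ys(3,1) f] \<open>y \<in> f\<close> by blast
  qed
qed force

lemma chain_of_sequence:
  assumes "\<And>i. i \<le> n \<Longrightarrow> p i \<in> box_edges m" "\<And>i. i < n \<Longrightarrow> adjacent (p i) (p (Suc i))"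
  shows "map p [0..<Suc n] \<in> chains m n (p 0)"
  using assms
proof (induction n arbitrary: p)
  case (Suc n)
  have tail: "map (\<lambda>i. p (Suc i)) [0..<Suc n] \<in> chains m n (p (Suc 0))"
    using Suc.prems by (intro Suc.IH) auto
  have split: "map p [0..<Suc (Suc n)] = p 0 # map (\<lambda>i. p (Suc i)) [0..<Suc n]"
    by (simp add: upt_conv_Cons flip: map_Suc_upt del: upt_Suc)
  show ?case unfolding split
    using tail Suc.prems(1)[of "Suc 0"] Suc.prems(2)[of 0] by (auto simp del: upt_Suc)
qed simp

text \<open>A path of minimal length does not visit a point twice.\<close>
lemma distinct_path_of_rtrancl:
  assumes "(a, b) \<in> R\<^sup>*"
  obtains p :: "nat \<Rightarrow> 'a" and n where "p 0 = a" "p n = b" "\<And>i. i < n \<Longrightarrow> (p i, p (Suc i)) \<in> R" "inj_on p {..n}"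
proof -
  define n where "n = (LEAST n. (a, b) \<in> R ^^ n)"
  have n: "(a, b) \<in> R ^^ n" unfolding n_def using assms by (metis LeastI_ex rtrancl_imp_relpow)
  then obtain p where p: "p 0 = a" "p n = b" "\<And>i. i < n \<Longrightarrow> (p i, p (Suc i)) \<in> R"
    by (auto simp: relpow_fun_conv)
  have sub: "(p i, p j) \<in> R ^^ (j - i)" if "i \<le> j" "j \<le> n" for i j
    using that p(3) by (auto simp: relpow_fun_conv intro!: exI[of _ "\<lambda>c. p (i + c)"])
  have "p i \<noteq> p j" if "i < j" "j \<le> n" for i j
  proof
    assume "p i = p j"
    then have "(a, b) \<in> R ^^ i O R ^^ (n - j)"
      using sub[of 0 i] sub[of j n] that p(1,2) by auto
    then have "(a, b) \<in> R ^^ (i + (n - j))" by (simp only: relpow_add)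
    then have "n \<le> i + (n - j)" unfolding n_def by (rule Least_le)
    then show False using that by simp
  qed
  then have "inj_on p {..n}" unfolding inj_on_def by (metis atMost_iff linorder_neqE_nat)
  then show ?thesis using that p by blast
qed

text \<open>The component \<open>K\<close> of \<open>e\<close> among the bad edges has to meet \<open>c\<close>: otherwise the closed edges outside \<open>K\<close> would
  separate until time \<open>s\<close>, whereas \<open>e\<close> belongs to all separating sets of closed edges at this time. As \<open>c\<close> is
  far from \<open>e\<close>, a shortest chain from \<open>e\<close> to \<open>c\<close> has at least \<open>n\<close> steps; its beginning is returned.\<close>
lemma long_bad_chain:
  fixes D :: "nat \<Rightarrow> 'd::finite edge set"
  assumes D_sub: "\<And>r. r \<le> s \<Longrightarrow> D r \<subseteq> bad"
    and sep: "\<And>r. r \<le> s \<Longrightarrow> separates k m (D r)"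
    and step: "\<And>r. r < s \<Longrightarrow> D (Suc r) \<subseteq> D r \<or> D r \<subseteq> D (Suc r)"
    and meet: "\<And>r. r < s \<Longrightarrow> \<exists>f. \<forall>S\<subseteq>D r. separates k m S \<longrightarrow> f \<in> S"
    and bad: "bad \<subseteq> box_edges m"
    and e: "\<And>S. S \<subseteq> D s \<Longrightarrow> separates k m S \<Longrightarrow> e \<in> S"
    and c: "c \<subseteq> D 0" "separates k m c"
    and far: "\<And>f x y. f \<in> c \<Longrightarrow> x \<in> e \<Longrightarrow> y \<in> f \<Longrightarrow> dist x y > 2 * real n"
  shows "\<exists>xs\<in>chains m n e. distinct xs \<and> set xs \<subseteq> bad"
proof -
  define R where "R = {(f, f'). f \<in> bad \<and> f' \<in> bad \<and> adjacent f f'}"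
  define K where "K = {f. (e, f) \<in> R\<^sup>*}"
  have e_bad: "e \<in> bad" using e[of "D s"] sep[of s] D_sub[of s] by auto
  have isolated: "\<not> adjacent f f'" if "f \<in> K" "f' \<in> bad - K" for f f'
  proof
    assume adj: "adjacent f f'"
    have "f \<in> bad" using that(1) e_bad unfolding K_def mem_Collect_eq
      by (cases rule: rtranclE) (auto simp: R_def)
    then have "(f, f') \<in> R" using adj that by (simp add: R_def)
    then have "f' \<in> K" using that(1) by (auto simp: K_def intro: rtrancl_into_rtrancl)
    then show False using that by simp
  qed
  have "\<not> separates k m (D 0 - K)"
  proof
    assume "separates k m (D 0 - K)"
    then have "separates k m (D s - K)"
      using separating_set_stays_outside[of s D bad k m K s] D_sub sep step meet isolated by blast
    then have "e \<notin> K" using e[of "D s - K"] by auto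
    then show False by (simp add: K_def)
  qed
  then have "\<not> c \<subseteq> D 0 - K"
    using separates_mono[OF c(2)] sep[of 0] by (auto simp: separates_def)
  then obtain f where f: "f \<in> c" "f \<in> K" using c by blast
  then obtain p L where p: "p 0 = e" "p L = f" "\<And>i. i < L \<Longrightarrow> (p i, p (Suc i)) \<in> R" "inj_on p {..L}"
    unfolding K_def by (blast elim: distinct_path_of_rtrancl)
  have p_bad: "p i \<in> bad" if "i \<le> L" for i
    using that p(1) e_bad p(3)[of "i - 1"] by (cases i) (auto simp: R_def)
  have chain: "map p [0..<Suc j] \<in> chains m j e" if "j \<le> L" for j
    using that p(3) p_bad bad unfolding p(1)[symmetric]
    by (intro chain_of_sequence) (auto simp: R_def)
  have "n \<le> L"
  proof (rule ccontr)
    assume "\<not> n \<le> L"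
    then have L: "L < n" by simp
    obtain x where x: "x \<in> e" using e_bad bad by (auto elim: box_edgeE)
    obtain y where "y \<in> f" "dist x y \<le> 2 * real L"
      using chain_close[OF chain[of L], of f] e_bad bad x p(2) by force
    then show False using far[OF f(1) x] L by fastforce
  qed
  have "distinct (map p [0..<Suc n])"
    unfolding distinct_map using p(4) \<open>n \<le> L\<close> by (auto intro: inj_on_subset simp del: upt_Suc)
  then show ?thesis using chain[OF \<open>n \<le> L\<close>] p_bad \<open>n \<le> L\<close>
    by (intro bexI[of _ "map p [0..<Suc n]"]) (auto simp del: upt_Suc)
qed

section \<open>The stationary law of the constrained configuration\<close>

definition constrained_step :: "'d::finite \<Rightarrow> nat \<Rightarrow> 'd edge \<times> bool \<Rightarrow> 'd config \<Rightarrow> 'd config" where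
  "constrained_step k m = (\<lambda>(e, b) y. y(e := (b \<and> \<not> top_bottom_connected k m (y(e := True)))))"

lemma snd_coupling_step: "snd (coupling_step k m n z) = constrained_step k m n (snd z)"
  by (cases n; cases z) (simp add: constrained_step_def)

definition disconnected :: "'d::finite \<Rightarrow> nat \<Rightarrow> 'd config set" where
  "disconnected k m = {\<eta> \<in> configs m. \<not> top_bottom_connected k m \<eta>}"

definition bernoulli_weight :: "real \<Rightarrow> nat \<Rightarrow> 'd::finite config \<Rightarrow> real" where
  "bernoulli_weight p m \<eta> = (\<Prod>f\<in>box_edges m. if \<eta> f then p else 1 - p)"

lemma finite_configs [simp]: "finite (configs m :: 'd::finite config set)"
  by (simp add: configs_def finite_PiE)

lemma finite_disconnected [simp]: "finite (disconnected k m)"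
  by (rule finite_subset[OF _ finite_configs[of m]]) (auto simp: disconnected_def)

lemma configs_upd: "\<eta> \<in> configs m \<Longrightarrow> f \<in> box_edges m \<Longrightarrow> \<eta>(f := b) \<in> configs m"
  by (auto simp: configs_def PiE_def extensional_def)

lemma top_bottom_connected_mono:
  "top_bottom_connected k m \<eta> \<Longrightarrow> (\<And>f. f \<in> box_edges m \<Longrightarrow> \<eta> f \<Longrightarrow> \<eta>' f) \<Longrightarrow> top_bottom_connected k m \<eta>'"
  unfolding top_bottom_connected_def crossing_path_def by blast

lemma disconnected_close: "\<eta> \<in> disconnected k m \<Longrightarrow> f \<in> box_edges m \<Longrightarrow> \<eta>(f := False) \<in> disconnected k m"
  using top_bottom_connected_mono[of k m "\<eta>(f := False)" \<eta>]
  by (fastforce simp: disconnected_def configs_upd split: if_splits)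

lemma constrained_step_disconnected:
  assumes "\<eta> \<in> disconnected k m" "fst n \<in> box_edges m"
  shows "constrained_step k m n \<eta> \<in> disconnected k m"
proof (cases n)
  case (Pair f b)
  show ?thesis
    using assms disconnected_close[OF assms(1), of f]
    by (cases "b \<and> \<not> top_bottom_connected k m (\<eta>(f := True))")
       (auto simp: constrained_step_def Pair disconnected_def configs_upd)
qed

lemma bernoulli_weight_pos: "0 < p \<Longrightarrow> p < 1 \<Longrightarrow> bernoulli_weight p m \<eta> > 0"
  by (auto simp: bernoulli_weight_def intro!: prod_pos)

lemma bernoulli_weight_flip:
  assumes "f \<in> box_edges m"
  shows "(1 - p) * bernoulli_weight p m (\<eta>(f := True)) = p * bernoulli_weight p m (\<eta>(f := False))"
proof -
  have "bernoulli_weight p m (\<eta>(f := b)) =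
      (if b then p else 1 - p) * (\<Prod>g\<in>box_edges m - {f}. if \<eta> g then p else 1 - p)" for b
    unfolding bernoulli_weight_def
    by (subst prod.remove[OF finite_box_edges assms]) (auto intro!: prod.cong)
  then show ?thesis by simp
qed

text \<open>The maximum principle. Where \<open>g\<close> is maximal, all terms of the average are maximal; in particular \<open>g\<close> is
  maximal also after closing one more edge, and finally at the configuration with all edges closed.\<close>
lemma harmonic_le_all_closed:
  fixes g :: "'d::finite config \<Rightarrow> real"
  assumes p: "0 < p" "p < 1"
    and harmonic: "\<And>\<eta>. \<eta> \<in> disconnected k m \<Longrightarrow> card (box_edges m :: 'd edge set) * g \<eta> =
      (\<Sum>f\<in>box_edges m. if \<eta> f then p * g \<eta> + (1 - p) * g (\<eta>(f := False))
         else if \<eta>(f := True) \<in> disconnected k m then (1 - p) * g \<eta> + p * g (\<eta>(f := True)) else g \<eta>)"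
    and \<eta>: "\<eta> \<in> disconnected k m"
  shows "g \<eta> \<le> g (\<lambda>f\<in>box_edges m. False)"
proof -
  define M where "M = Max (g ` disconnected k m)"
  have le: "g \<xi> \<le> M" if "\<xi> \<in> disconnected k m" for \<xi>
    unfolding M_def using that by (intro Max_ge) auto
  have mix: "a * u + b * v \<le> M" if "a + b = 1" "a \<ge> 0" "b \<ge> 0" "u \<le> M" "v \<le> M" for a b u v :: real
    using convex_bound_le[OF that(4,5,2,3,1)] by simp
  have "M \<in> g ` disconnected k m" unfolding M_def using \<eta> by (intro Max_in) auto
  then obtain \<xi> where "\<xi> \<in> disconnected k m" "g \<xi> = M" by auto
  then have "g (\<lambda>f\<in>box_edges m. False) = M"
  proof (induction "card {f \<in> box_edges m. \<xi> f}" arbitrary: \<xi>)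
    case 0
    then have "\<xi> = (\<lambda>f\<in>box_edges m. False)"
      by (auto simp: disconnected_def configs_def PiE_def extensional_def fun_eq_iff)
    then show ?case using 0 by simp
  next
    case (Suc c)
    then have "{f \<in> box_edges m. \<xi> f} \<noteq> {}" by force
    then obtain f where f: "f \<in> box_edges m" "\<xi> f" by blast
    define a where "a f = (if \<xi> f then p * g \<xi> + (1 - p) * g (\<xi>(f := False))
         else if \<xi>(f := True) \<in> disconnected k m then (1 - p) * g \<xi> + p * g (\<xi>(f := True)) else g \<xi>)" for f
    have a_le: "a f \<le> M" if "f \<in> box_edges m" for f
      using that le[OF Suc.prems(1)] le[OF disconnected_close[OF Suc.prems(1) that]] le p
      unfolding a_def by (auto intro!: mix)
    have "(\<Sum>f\<in>box_edges m. M - a f) = 0"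
      using harmonic[OF Suc.prems(1)] Suc.prems(2) by (simp add: a_def sum_subtractf)
    then have "M - a f = 0"
      using a_le f(1) by (subst (asm) sum_nonneg_eq_0_iff) auto
    then have "(1 - p) * g (\<xi>(f := False)) = (1 - p) * M"
      using f(2) Suc.prems(2) by (simp add: a_def algebra_simps)
    then have "g (\<xi>(f := False)) = M" using p by simp
    moreover have "{h \<in> box_edges m. \<xi> h} = insert f {h \<in> box_edges m. (\<xi>(f := False)) h}"
      using f by auto
    then have "c = card {h \<in> box_edges m. (\<xi>(f := False)) h}"
      using Suc.hyps(2) by simp
    ultimately show ?case
      using Suc.hyps(1)[of "\<xi>(f := False)"] disconnected_close[OF Suc.prems(1) f(1)] by simp
  qed
  then show ?thesis using le[OF \<eta>] by simp
qed

lemma pmf_coupling_noise: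
  assumes "f \<in> (box_edges m :: 'd::finite edge set)" "0 \<le> p" "p \<le> 1"
  shows "pmf (coupling_noise p m) (f, b) = (if b then p else 1 - p) / card (box_edges m :: 'd edge set)"
proof -
  have "box_edges m \<noteq> ({} :: 'd edge set)" using assms by auto
  then show ?thesis using assms by (cases b) (simp_all add: coupling_noise_def pmf_pair pmf_of_set)
qed

lemma set_pmf_coupling_noise:
  assumes "box_edges m \<noteq> ({} :: 'd::finite edge set)" "0 < p" "p < 1"
  shows "set_pmf (coupling_noise p m) = (box_edges m :: 'd edge set) \<times> UNIV"
  using assms by (simp add: coupling_noise_def set_pmf_of_set set_pmf_bernoulli)

text \<open>A single update at \<open>f\<close> forgets only the state of \<open>f\<close>, so the candidates for preimages of \<open>\<eta>\<close> are \<open>\<eta>\<close> and its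
  flip at \<open>f\<close>.\<close>
lemma constrained_preimages:
  assumes \<eta>: "\<eta> \<in> disconnected k m" and f: "f \<in> box_edges m"
  defines "V \<equiv> \<lambda>b. {\<xi> \<in> disconnected k m. constrained_step k m (f, b) \<xi> = \<eta>}"
  shows "\<eta> f \<Longrightarrow> V True = {\<eta>, \<eta>(f := False)}" "\<eta> f \<Longrightarrow> V False = {}"
    "\<not> \<eta> f \<Longrightarrow> \<eta>(f := True) \<in> disconnected k m \<Longrightarrow> V True = {}"
    "\<not> \<eta> f \<Longrightarrow> \<eta>(f := True) \<in> disconnected k m \<Longrightarrow> V False = {\<eta>, \<eta>(f := True)}"
    "\<not> \<eta> f \<Longrightarrow> \<eta>(f := True) \<notin> disconnected k m \<Longrightarrow> V b = {\<eta>}"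
proof -
  have conf: "\<xi> \<in> configs m" "\<not> top_bottom_connected k m \<xi>" if "\<xi> \<in> disconnected k m" for \<xi>
    using that by (auto simp: disconnected_def)
  have open_iff: "\<eta>(f := True) \<in> disconnected k m \<longleftrightarrow> \<not> top_bottom_connected k m (\<eta>(f := True))"
    using \<eta> f by (simp add: disconnected_def configs_upd)
  have agree: "\<xi> = \<eta>(f := \<xi> f)" if "constrained_step k m (f, b) \<xi> = \<eta>" for \<xi> b
    using that by (auto simp: constrained_step_def)
  have cases: "\<xi> = \<eta>(f := True) \<or> \<xi> = \<eta>(f := False)" if "constrained_step k m (f, b) \<xi> = \<eta>" for \<xi> b
    using agree[OF that] by (cases "\<xi> f") auto
  have step: "constrained_step k m (f, b) (\<eta>(f := c)) = \<eta> \<longleftrightarrow>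
      \<eta> f = (b \<and> \<not> top_bottom_connected k m (\<eta>(f := True)))" for b c
    by (auto simp: constrained_step_def fun_eq_iff)
  have V: "V b = {\<xi> \<in> {\<eta>(f := True), \<eta>(f := False)}. \<xi> \<in> disconnected k m \<and>
      \<eta> f = (b \<and> \<not> top_bottom_connected k m (\<eta>(f := True)))}" for b
  proof (intro set_eqI iffI)
    fix \<xi> assume "\<xi> \<in> V b"
    then have \<xi>: "\<xi> \<in> disconnected k m" "constrained_step k m (f, b) \<xi> = \<eta>" by (simp_all add: V_def)
    obtain c where c: "\<xi> = \<eta>(f := c)" "c = True \<or> c = False" using cases[OF \<xi>(2)] by blast
    from \<xi>(2) have "\<eta> f = (b \<and> \<not> top_bottom_connected k m (\<eta>(f := True)))" unfolding c(1) step .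
    then show "\<xi> \<in> {\<xi> \<in> {\<eta>(f := True), \<eta>(f := False)}. \<xi> \<in> disconnected k m \<and>
        \<eta> f = (b \<and> \<not> top_bottom_connected k m (\<eta>(f := True)))}" using \<xi>(1) cases[OF \<xi>(2)] by simp
  next
    fix \<xi> assume *: "\<xi> \<in> {\<xi> \<in> {\<eta>(f := True), \<eta>(f := False)}. \<xi> \<in> disconnected k m \<and>
        \<eta> f = (b \<and> \<not> top_bottom_connected k m (\<eta>(f := True)))}"
    then obtain c where c: "\<xi> = \<eta>(f := c)" by blast
    then have "constrained_step k m (f, b) \<xi> = \<eta>" unfolding c step using * by simp
    then show "\<xi> \<in> V b" using * by (simp add: V_def)
  qed
  have close: "\<eta>(f := False) \<in> disconnected k m" by (rule disconnected_close[OF \<eta> f])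
  show "V True = {\<eta>, \<eta>(f := False)}" "V False = {}" if "\<eta> f"
  proof -
    have "\<eta>(f := True) = \<eta>" by (rule fun_upd_idem) (simp add: that)
    then show "V True = {\<eta>, \<eta>(f := False)}" "V False = {}"
      unfolding V using that close \<eta> conf[OF \<eta>] by auto
  qed
  have "\<eta>(f := False) = \<eta>" if "\<not> \<eta> f" by (rule fun_upd_idem) (simp add: that)
  then show "\<not> \<eta> f \<Longrightarrow> \<eta>(f := True) \<in> disconnected k m \<Longrightarrow> V True = {}"
    "\<not> \<eta> f \<Longrightarrow> \<eta>(f := True) \<in> disconnected k m \<Longrightarrow> V False = {\<eta>, \<eta>(f := True)}"
    "\<not> \<eta> f \<Longrightarrow> \<eta>(f := True) \<notin> disconnected k m \<Longrightarrow> V b = {\<eta>}"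
    unfolding V using close open_iff \<eta> by auto
qed

text \<open>Conditioned Bernoulli percolation is reversible for the constrained dynamics. Therefore the density \<open>g\<close> of
  any stationary law with respect to the Bernoulli weight is harmonic, and the maximum principle for \<open>g\<close> and
  \<open>- g\<close> makes it constant on the disconnected configurations.\<close>
lemma equilibrium_marginal:
  fixes \<mu> :: "('d::finite config \<times> 'd config) pmf"
  assumes p: "0 < p" "p < 1" and ne: "box_edges m \<noteq> ({} :: 'd edge set)" and eq: "equilibrium k m p \<mu>"
  shows "\<exists>C. \<forall>\<eta>\<in>disconnected k m. pmf (map_pmf snd \<mu>) \<eta> = C * bernoulli_weight p m \<eta>"
    and "set_pmf (map_pmf snd \<mu>) \<subseteq> disconnected k m"
proof -
  define \<nu> where "\<nu> = map_pmf snd \<mu>"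
  let ?E = "box_edges m :: 'd edge set" and ?w = "bernoulli_weight p m"
  show supp: "set_pmf (map_pmf snd \<mu>) \<subseteq> disconnected k m"
    using eq by (auto simp: equilibrium_def coupling_states_def disconnected_def)
  have E: "finite ?E" "card ?E > 0" using ne by (simp_all add: card_gt_0_iff)
  have "\<nu> = map_pmf snd (bind_pmf \<mu> (\<lambda>z. map_pmf (\<lambda>n. coupling_step k m n z) (coupling_noise p m)))"
    using eq by (simp add: \<nu>_def equilibrium_def)
  also have "\<dots> = bind_pmf \<nu> (\<lambda>y. map_pmf (\<lambda>n. constrained_step k m n y) (coupling_noise p m))"
    by (simp add: \<nu>_def map_bind_pmf bind_map_pmf pmf.map_comp o_def snd_coupling_step)
  also have "\<dots> = bind_pmf (coupling_noise p m) (\<lambda>n. map_pmf (constrained_step k m n) \<nu>)"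
    unfolding map_pmf_def by (rule bind_commute_pmf)
  finally have stat: "\<nu> = bind_pmf (coupling_noise p m) (\<lambda>n. map_pmf (constrained_step k m n) \<nu>)" .
  have pre: "measure \<nu> (constrained_step k m n -` {\<eta>}) =
      (\<Sum>\<xi>\<in>{\<xi> \<in> disconnected k m. constrained_step k m n \<xi> = \<eta>}. pmf \<nu> \<xi>)" for n \<eta>
  proof -
    have "measure \<nu> (constrained_step k m n -` {\<eta>}) = measure \<nu> {\<xi> \<in> disconnected k m. constrained_step k m n \<xi> = \<eta>}"
      by (rule measure_pmf.finite_measure_eq_AE)
         (use supp in \<open>auto simp: AE_measure_pmf_iff \<nu>_def\<close>)
    then show ?thesis by (simp add: measure_measure_pmf_finite)
  qed
  \<comment> \<open>the probability flow into \<open>\<eta>\<close> through updates of the edge \<open>f\<close>, up to the factor \<open>1 / card ?E\<close>\<close>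
  define flow where "flow \<eta> f = (\<Sum>b\<in>UNIV. (if b then p else 1 - p) *
      (\<Sum>\<xi>\<in>{\<xi> \<in> disconnected k m. constrained_step k m (f, b) \<xi> = \<eta>}. pmf \<nu> \<xi>))" for \<eta> f
  have balance: "card ?E * pmf \<nu> \<eta> = (\<Sum>f\<in>?E. flow \<eta> f)" for \<eta>
  proof -
    have "pmf \<nu> \<eta> = (\<integral>n. pmf (map_pmf (constrained_step k m n) \<nu>) \<eta> \<partial>coupling_noise p m)"
      by (subst stat) (rule pmf_bind)
    also have "\<dots> = (\<Sum>n\<in>?E \<times> UNIV. pmf (coupling_noise p m) n * pmf (map_pmf (constrained_step k m n) \<nu>) \<eta>)"
      by (subst integral_measure_pmf[of "?E \<times> UNIV"]) (use set_pmf_coupling_noise[OF ne p] E in \<open>auto\<close>)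
    also have "\<dots> = (\<Sum>f\<in>?E. \<Sum>b\<in>UNIV. pmf (coupling_noise p m) (f, b) * pmf (map_pmf (constrained_step k m (f, b)) \<nu>) \<eta>)"
      by (simp add: sum.cartesian_product)
    also have "\<dots> = (\<Sum>f\<in>?E. flow \<eta> f / card ?E)"
      unfolding flow_def sum_divide_distrib pmf_map pre
      by (intro sum.cong refl) (use p in \<open>simp add: pmf_coupling_noise\<close>)
    finally show ?thesis using E by (simp flip: sum_divide_distrib)
  qed
  define g where "g \<eta> = pmf \<nu> \<eta> / ?w \<eta>" for \<eta>
  have wpos: "?w \<eta> > 0" for \<eta> :: "'d config" using p by (rule bernoulli_weight_pos)
  have \<nu>_g: "pmf \<nu> \<eta> = ?w \<eta> * g \<eta>" for \<eta> using wpos[of \<eta>] by (simp add: g_def)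
  have flow_g: "flow \<eta> f = ?w \<eta> * (if \<eta> f then p * g \<eta> + (1 - p) * g (\<eta>(f := False))
         else if \<eta>(f := True) \<in> disconnected k m then (1 - p) * g \<eta> + p * g (\<eta>(f := True)) else g \<eta>)"
    if \<eta>: "\<eta> \<in> disconnected k m" and f: "f \<in> ?E" for \<eta> f
  proof -
    note pre = constrained_preimages[OF \<eta> f]
    have flow: "flow \<eta> f =
        p * (\<Sum>\<xi>\<in>{\<xi> \<in> disconnected k m. constrained_step k m (f, True) \<xi> = \<eta>}. pmf \<nu> \<xi>) +
        (1 - p) * (\<Sum>\<xi>\<in>{\<xi> \<in> disconnected k m. constrained_step k m (f, False) \<xi> = \<eta>}. pmf \<nu> \<xi>)"
      by (simp add: flow_def UNIV_bool)
    note flip = bernoulli_weight_flip[OF f, of p \<eta>]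
    consider "\<eta> f" | "\<not> \<eta> f" "\<eta>(f := True) \<in> disconnected k m" | "\<not> \<eta> f" "\<eta>(f := True) \<notin> disconnected k m" by blast
    then show ?thesis
    proof cases
      case 1
      then have "\<eta>(f := True) = \<eta>" "\<eta> \<noteq> \<eta>(f := False)" by (auto simp: fun_eq_iff)
      then have "flow \<eta> f = p * (?w \<eta> * g \<eta>) + (p * ?w (\<eta>(f := False))) * g (\<eta>(f := False))"
        unfolding flow pre(1)[OF 1] pre(2)[OF 1] using \<open>\<eta> \<noteq> \<eta>(f := False)\<close> by (simp add: \<nu>_g algebra_simps)
      also have "p * ?w (\<eta>(f := False)) = (1 - p) * ?w \<eta>" using flip \<open>\<eta>(f := True) = \<eta>\<close> by simp
      finally show ?thesis using 1 by (simp add: algebra_simps del: fun_upd_apply)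
    next
      case 2
      then have "\<eta>(f := False) = \<eta>" "\<eta> \<noteq> \<eta>(f := True)" by (auto simp: fun_eq_iff)
      then have "flow \<eta> f = (1 - p) * (?w \<eta> * g \<eta>) + ((1 - p) * ?w (\<eta>(f := True))) * g (\<eta>(f := True))"
        unfolding flow pre(3)[OF 2] pre(4)[OF 2] using \<open>\<eta> \<noteq> \<eta>(f := True)\<close> by (simp add: \<nu>_g algebra_simps)
      also have "(1 - p) * ?w (\<eta>(f := True)) = p * ?w \<eta>" using flip \<open>\<eta>(f := False) = \<eta>\<close> by simp
      finally show ?thesis using 2 by (simp add: algebra_simps del: fun_upd_apply)
    next
      case 3
      then have "flow \<eta> f = ?w \<eta> * g \<eta>"
        unfolding flow pre(5)[OF 3] by (simp add: \<nu>_g algebra_simps)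
      then show ?thesis using 3 by simp
    qed
  qed
  have harm: "card ?E * g \<eta> =
      (\<Sum>f\<in>?E. if \<eta> f then p * g \<eta> + (1 - p) * g (\<eta>(f := False))
         else if \<eta>(f := True) \<in> disconnected k m then (1 - p) * g \<eta> + p * g (\<eta>(f := True)) else g \<eta>)"
    (is "_ = ?S") if \<eta>: "\<eta> \<in> disconnected k m" for \<eta>
  proof -
    have "?w \<eta> * (card ?E * g \<eta>) = card ?E * pmf \<nu> \<eta>" by (simp add: \<nu>_g)
    also have "\<dots> = (\<Sum>f\<in>?E. flow \<eta> f)" by (rule balance)
    also have "\<dots> = ?w \<eta> * ?S" unfolding sum_distrib_left by (intro sum.cong refl flow_g \<eta>)
    finally show ?thesis using wpos[of \<eta>] by simp
  qed
  have "g \<eta> = g (\<lambda>f\<in>?E. False)" if \<eta>: "\<eta> \<in> disconnected k m" for \<eta>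
  proof (rule antisym)
    show "g \<eta> \<le> g (\<lambda>f\<in>?E. False)" by (rule harmonic_le_all_closed[OF p harm \<eta>])
    have "- g \<eta> \<le> - g (\<lambda>f\<in>?E. False)"
    proof (rule harmonic_le_all_closed[OF p _ \<eta>, of "\<lambda>\<eta>. - g \<eta>"])
      fix \<eta> assume "\<eta> \<in> disconnected k m"
      from harm[OF this] show "card ?E * - g \<eta> =
        (\<Sum>f\<in>?E. if \<eta> f then p * - g \<eta> + (1 - p) * - g (\<eta>(f := False))
         else if \<eta>(f := True) \<in> disconnected k m then (1 - p) * - g \<eta> + p * - g (\<eta>(f := True)) else - g \<eta>)"
        by (simp only: mult_minus_right sum_negf[symmetric]) (intro sum.cong refl, auto)
    qed
    then show "g (\<lambda>f\<in>?E. False) \<le> g \<eta>" by simp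
  qed
  then show "\<exists>C. \<forall>\<eta>\<in>disconnected k m. pmf (map_pmf snd \<mu>) \<eta> = C * bernoulli_weight p m \<eta>"
    using \<nu>_g unfolding \<nu>_def by (intro exI[of _ "g (\<lambda>f\<in>?E. False)"]) (simp add: mult.commute)
qed

text \<open>For a single edge \<open>a\<close>, opening it maps the configurations of \<open>F\<close> with \<open>a\<close> closed bijectively
  to those with \<open>a\<close> open and multiplies the weight by \<open>p / (1 - p)\<close>.\<close>
lemma sum_bernoulli_weight_closed:
  fixes F :: "'d::finite config set"
  assumes p: "p < 1" and F: "F \<subseteq> configs m" and A: "finite A" "A \<subseteq> box_edges m"
    and inv: "\<And>\<eta> a b. \<eta> \<in> configs m \<Longrightarrow> a \<in> A \<Longrightarrow> \<eta>(a := b) \<in> F \<longleftrightarrow> \<eta> \<in> F"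
  shows "(\<Sum>\<eta>\<in>{\<eta> \<in> F. \<forall>a\<in>A. \<not> \<eta> a}. bernoulli_weight p m \<eta>) = (1 - p) ^ card A * (\<Sum>\<eta>\<in>F. bernoulli_weight p m \<eta>)"
  using A inv
proof (induction A rule: finite_induct)
  case (insert a A)
  let ?w = "bernoulli_weight p m"
  define G where "G = {\<eta> \<in> F. \<forall>a\<in>A. \<not> \<eta> a}"
  have G: "G \<subseteq> configs m" "finite G"
    using F finite_subset[OF F] by (auto simp: G_def)
  have a: "a \<in> box_edges m" using insert.prems by simp
  have G_inv: "\<eta>(a := b) \<in> G \<longleftrightarrow> \<eta> \<in> G" if "\<eta> \<in> configs m" for \<eta> b
  proof -
    have "(\<forall>a'\<in>A. \<not> (\<eta>(a := b)) a') \<longleftrightarrow> (\<forall>a'\<in>A. \<not> \<eta> a')"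
      using insert.hyps(2) by (intro ball_cong refl) auto
    moreover have "\<eta>(a := b) \<in> F \<longleftrightarrow> \<eta> \<in> F" by (rule insert.prems(2)[OF that insertI1])
    ultimately show ?thesis unfolding G_def by blast
  qed
  let ?C = "{\<eta> \<in> G. \<not> \<eta> a}" and ?O = "{\<eta> \<in> G. \<eta> a}"
  have bij: "bij_betw (\<lambda>\<eta>. \<eta>(a := True)) ?C ?O"
  proof (rule bij_betwI[where g = "\<lambda>\<eta>. \<eta>(a := False)"])
    show "(\<lambda>\<eta>. \<eta>(a := True)) \<in> ?C \<rightarrow> ?O" "(\<lambda>\<eta>. \<eta>(a := False)) \<in> ?O \<rightarrow> ?C" using G_inv G by auto
  qed (auto simp: fun_eq_iff)
  have "(1 - p) * (\<Sum>\<eta>\<in>?O. ?w \<eta>) = (\<Sum>\<eta>\<in>?C. (1 - p) * ?w (\<eta>(a := True)))"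
    unfolding sum_distrib_left by (rule sum.reindex_bij_betw[OF bij, symmetric])
  also have "\<dots> = p * (\<Sum>\<eta>\<in>?C. ?w \<eta>)"
    unfolding sum_distrib_left bernoulli_weight_flip[OF a]
    by (intro sum.cong refl arg_cong[where f = "\<lambda>\<eta>. p * ?w \<eta>"]) (auto simp: fun_eq_iff)
  finally have O: "(1 - p) * (\<Sum>\<eta>\<in>?O. ?w \<eta>) = p * (\<Sum>\<eta>\<in>?C. ?w \<eta>)" .
  have "(\<Sum>\<eta>\<in>G. ?w \<eta>) = (\<Sum>\<eta>\<in>?C \<union> ?O. ?w \<eta>)" by (intro sum.cong) auto
  also have "\<dots> = (\<Sum>\<eta>\<in>?C. ?w \<eta>) + (\<Sum>\<eta>\<in>?O. ?w \<eta>)" using G by (intro sum.union_disjoint) auto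
  finally have "(\<Sum>\<eta>\<in>?C. ?w \<eta>) = (1 - p) * (\<Sum>\<eta>\<in>G. ?w \<eta>)" using O by (simp add: algebra_simps)
  moreover have "{\<eta> \<in> F. \<forall>a\<in>insert a A. \<not> \<eta> a} = ?C" by (auto simp: G_def)
  ultimately show ?case using insert.IH insert.prems insert.hyps by (simp add: G_def)
qed simp

text \<open>An event that implies disconnection and does not depend on the edges of \<open>A\<close> absorbs the conditioning:
  given this event, the edges of \<open>A\<close> are independent and closed with probability \<open>1 - p\<close>.\<close>
lemma equilibrium_closed_edges:
  fixes \<mu> :: "('d::finite config \<times> 'd config) pmf"
  assumes p: "0 < p" "p < 1" and eq: "equilibrium k m p \<mu>"
    and ne: "box_edges m \<noteq> ({} :: 'd edge set)"
    and F: "F \<subseteq> disconnected k m" and A: "A \<subseteq> box_edges m"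
    and inv: "\<And>\<eta> a b. \<eta> \<in> configs m \<Longrightarrow> a \<in> A \<Longrightarrow> \<eta>(a := b) \<in> F \<longleftrightarrow> \<eta> \<in> F"
  shows "measure \<mu> {z. snd z \<in> F \<and> (\<forall>a\<in>A. \<not> snd z a)} = (1 - p) ^ card A * measure \<mu> {z. snd z \<in> F}"
proof -
  obtain C where C: "\<And>\<eta>. \<eta> \<in> disconnected k m \<Longrightarrow> pmf (map_pmf snd \<mu>) \<eta> = C * bernoulli_weight p m \<eta>"
    using equilibrium_marginal(1)[OF p ne eq] by blast
  have meas: "measure \<mu> {z. snd z \<in> H} = C * (\<Sum>\<eta>\<in>H. bernoulli_weight p m \<eta>)" if H: "H \<subseteq> F" for H
  proof -
    have "measure \<mu> {z. snd z \<in> H} = measure (map_pmf snd \<mu>) H" by (simp add: vimage_def)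
    also have "\<dots> = (\<Sum>\<eta>\<in>H. pmf (map_pmf snd \<mu>) \<eta>)"
      using H F finite_subset[of H "disconnected k m"] by (intro measure_measure_pmf_finite) auto
    also have "\<dots> = (\<Sum>\<eta>\<in>H. C * bernoulli_weight p m \<eta>)"
      by (intro sum.cong refl C) (use H F in auto)
    finally show ?thesis by (simp add: sum_distrib_left)
  qed
  have "finite A" using A by (rule finite_subset) simp
  then show ?thesis
    using sum_bernoulli_weight_closed[OF p(2) _ _ A inv] meas[of F] meas[of "{\<eta> \<in> F. \<forall>a\<in>A. \<not> \<eta> a}"] F
    by (auto simp: disconnected_def)
qed

section \<open>Space-time independence\<close>

lemma space_on_support [simp]: "space (on_support q) = set_pmf q"
  by (simp add: on_support_def space_restrict_space)

lemma sets_on_support [simp]: "sets (on_support q) = Pow (set_pmf q)"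
  by (auto simp: on_support_def sets_restrict_space)

lemma emeasure_on_support: "A \<subseteq> set_pmf q \<Longrightarrow> emeasure (on_support q) A = emeasure (measure_pmf q) A"
  by (simp add: on_support_def emeasure_restrict_space)

lemma prob_space_on_support: "prob_space (on_support q)"
  unfolding on_support_def
  by (rule prob_space_restrict_space) (simp_all add: measure_pmf.emeasure_eq_measure measure_pmf.prob_eq_1 AE_measure_pmf)

lemma prob_space_coupling_space: "prob_space (coupling_space m p \<mu>)"
  unfolding coupling_space_def
  by (intro prob_space_pair prob_space_PiM prob_space_on_support)

lemma in_space_coupling_space:
  assumes "w \<in> space (coupling_space m p \<mu>)"
  shows "fst w \<in> set_pmf \<mu>" and "t \<ge> 1 \<Longrightarrow> snd w t \<in> set_pmf (coupling_noise p m)"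
  using assms by (auto simp: coupling_space_def space_pair_measure space_PiM PiE_def Pi_def)

lemma initial_state_indep_noise:
  fixes \<mu> :: "('d::finite config \<times> 'd config) pmf" and v :: "nat \<Rightarrow> 'd edge \<times> bool" and m :: nat and p :: real
  defines "M \<equiv> coupling_space m p \<mu>"
  assumes J: "finite J" "J \<subseteq> {1..}" and v: "\<And>j. j \<in> J \<Longrightarrow> v j \<in> set_pmf (coupling_noise p m)"
  shows "{w \<in> space M. fst w \<in> S \<and> (\<forall>j\<in>J. snd w j = v j)} \<in> sets M"
    and "measure M {w \<in> space M. fst w \<in> S \<and> (\<forall>j\<in>J. snd w j = v j)} =
      measure \<mu> S * (\<Prod>j\<in>J. pmf (coupling_noise p m) (v j))"
proof -
  let ?N = "on_support (coupling_noise p m :: ('d edge \<times> bool) pmf)"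
  interpret N: product_prob_space "\<lambda>_. ?N" "{1::nat..}"
    by (intro product_prob_spaceI prob_space_on_support)
  interpret M: prob_space M unfolding M_def by (rule prob_space_coupling_space)
  let ?B = "prod_emb {1..} (\<lambda>_. ?N) J (PiE J (\<lambda>j. {v j}))"
  have eq: "{w \<in> space M. fst w \<in> S \<and> (\<forall>j\<in>J. snd w j = v j)} = (S \<inter> set_pmf \<mu>) \<times> ?B"
    using J by (auto simp: M_def coupling_space_def space_pair_measure space_PiM prod_emb_def PiE_iff
        extensional_def restrict_def)
  have B: "?B \<in> sets (\<Pi>\<^sub>M t\<in>{1..}. ?N)" using J v by (intro sets_PiM_I) auto
  have S: "S \<inter> set_pmf \<mu> \<in> sets (on_support \<mu>)" by simp
  show "{w \<in> space M. fst w \<in> S \<and> (\<forall>j\<in>J. snd w j = v j)} \<in> sets M"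
    unfolding eq unfolding M_def coupling_space_def using S B by (rule pair_measureI)
  have "emeasure M ((S \<inter> set_pmf \<mu>) \<times> ?B) = emeasure (on_support \<mu>) (S \<inter> set_pmf \<mu>) * emeasure (\<Pi>\<^sub>M t\<in>{1..}. ?N) ?B"
    unfolding M_def coupling_space_def by (rule N.P.emeasure_pair_measure_Times[OF S B])
  also have "emeasure (\<Pi>\<^sub>M t\<in>{1..}. ?N) ?B = (\<Prod>j\<in>J. emeasure ?N {v j})"
    using J v by (intro N.emeasure_PiM_emb) auto
  also have "\<dots> = (\<Prod>j\<in>J. ennreal (pmf (coupling_noise p m) (v j)))"
    using v by (intro prod.cong refl) (simp add: emeasure_on_support emeasure_pmf_single)
  also have "emeasure (on_support \<mu>) (S \<inter> set_pmf \<mu>) = emeasure \<mu> S"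
    by (simp add: emeasure_on_support emeasure_Int_set_pmf)
  finally have "ennreal (measure M ((S \<inter> set_pmf \<mu>) \<times> ?B)) =
      ennreal (measure \<mu> S * (\<Prod>j\<in>J. pmf (coupling_noise p m) (v j)))"
    by (simp add: M.emeasure_eq_measure measure_pmf.emeasure_eq_measure prod_ennreal ennreal_mult prod_nonneg)
  then show "measure M {w \<in> space M. fst w \<in> S \<and> (\<forall>j\<in>J. snd w j = v j)} =
      measure \<mu> S * (\<Prod>j\<in>J. pmf (coupling_noise p m) (v j))"
    unfolding eq by (simp add: prod_nonneg)
qed

lemma equilibrium_measure_step:
  fixes \<mu> :: "('d::finite config \<times> 'd config) pmf"
  assumes "equilibrium k m p \<mu>" and fin: "finite (set_pmf (coupling_noise p m :: ('d edge \<times> bool) pmf))"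
  shows "measure \<mu> S = (\<Sum>n\<in>set_pmf (coupling_noise p m). measure \<mu> (coupling_step k m n -` S) * pmf (coupling_noise p m) n)"
proof -
  have prob: "measure q S = pmf (map_pmf (\<lambda>z. z \<in> S) q) True" for q :: "('d config \<times> 'd config) pmf"
    by (simp add: pmf_map vimage_def)
  have "\<mu> = bind_pmf \<mu> (\<lambda>z. map_pmf (\<lambda>n. coupling_step k m n z) (coupling_noise p m))"
    using assms(1) by (simp add: equilibrium_def)
  also have "\<dots> = bind_pmf (coupling_noise p m) (\<lambda>n. map_pmf (coupling_step k m n) \<mu>)"
    unfolding map_pmf_def by (rule bind_commute_pmf)
  finally have stat: "\<mu> = bind_pmf (coupling_noise p m) (\<lambda>n. map_pmf (coupling_step k m n) \<mu>)" .
  have "measure \<mu> S = pmf (bind_pmf (coupling_noise p m) (\<lambda>n. map_pmf (\<lambda>z. coupling_step k m n z \<in> S) \<mu>)) True"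
    by (subst stat) (simp add: prob map_bind_pmf pmf.map_comp o_def)
  also have "\<dots> = (\<integral>n. measure \<mu> (coupling_step k m n -` S) \<partial>coupling_noise p m)"
    by (simp add: pmf_bind pmf_map vimage_def)
  also have "\<dots> = (\<Sum>n\<in>set_pmf (coupling_noise p m). pmf (coupling_noise p m) n * measure \<mu> (coupling_step k m n -` S))"
    by (subst integral_measure_pmf[OF fin]) auto
  finally show ?thesis by (simp add: mult.commute)
qed

text \<open>The induction on \<open>t\<close> decomposes the event according to the noise at time \<open>Suc t\<close>, which turns it into
  events of the same form at time \<open>t\<close> with one more prescribed value; stationarity sums them up. The sets
  \<open>S\<close> and \<open>J\<close> and the values \<open>v\<close> are arbitrary for this reason.\<close>
lemma present_state_indep_future_noise:
  fixes \<mu> :: "('d::finite config \<times> 'd config) pmf" and v :: "nat \<Rightarrow> 'd edge \<times> bool" and m :: nat and p :: real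
  defines "M \<equiv> coupling_space m p \<mu>"
  assumes eq: "equilibrium k m p \<mu>" and fin: "finite (set_pmf (coupling_noise p m :: ('d edge \<times> bool) pmf))"
    and "finite J" "J \<subseteq> {t<..}" "\<And>j. j \<in> J \<Longrightarrow> v j \<in> set_pmf (coupling_noise p m)"
  shows "{w \<in> space M. coupled_chain k m t w \<in> S \<and> (\<forall>j\<in>J. snd w j = v j)} \<in> sets M \<and>
    measure M {w \<in> space M. coupled_chain k m t w \<in> S \<and> (\<forall>j\<in>J. snd w j = v j)} =
      measure \<mu> S * (\<Prod>j\<in>J. pmf (coupling_noise p m) (v j))"
  using assms(4-)
proof (induction t arbitrary: S J v)
  case 0
  then have "J \<subseteq> {1..}" by auto
  then show ?case
    using initial_state_indep_noise[of J v p m \<mu> S] 0 unfolding M_def by simp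
next
  case (Suc t)
  interpret M: prob_space M unfolding M_def by (rule prob_space_coupling_space)
  let ?N = "coupling_noise p m :: ('d edge \<times> bool) pmf"
  define G where "G n = {w \<in> space M. coupled_chain k m t w \<in> coupling_step k m n -` S \<and>
      (\<forall>j\<in>insert (Suc t) J. snd w j = (v(Suc t := n)) j)}" for n
  have t_J: "Suc t \<notin> J" using Suc.prems(2) by auto
  have G: "G n \<in> sets M \<and> measure M (G n) =
      measure \<mu> (coupling_step k m n -` S) * (pmf ?N n * (\<Prod>j\<in>J. pmf ?N (v j)))" if n: "n \<in> set_pmf ?N" for n
  proof -
    have "(\<Prod>j\<in>insert (Suc t) J. pmf ?N ((v(Suc t := n)) j)) = pmf ?N n * (\<Prod>j\<in>J. pmf ?N (v j))"
      using Suc.prems(1) t_J by (subst prod.insert) (auto intro!: prod.cong)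
    moreover have "insert (Suc t) J \<subseteq> {t<..}" using Suc.prems(2) by auto
    moreover have "(v(Suc t := n)) j \<in> set_pmf ?N" if "j \<in> insert (Suc t) J" for j
      using that n Suc.prems(3) by auto
    ultimately show ?thesis
      using Suc.IH[of "insert (Suc t) J" "v(Suc t := n)" "coupling_step k m n -` S"] Suc.prems(1)
      unfolding G_def by simp
  qed
  have ev: "{w \<in> space M. coupled_chain k m (Suc t) w \<in> S \<and> (\<forall>j\<in>J. snd w j = v j)} = (\<Union>n\<in>set_pmf ?N. G n)"
  proof (intro set_eqI iffI)
    fix w assume w: "w \<in> {w \<in> space M. coupled_chain k m (Suc t) w \<in> S \<and> (\<forall>j\<in>J. snd w j = v j)}"
    then have "snd w (Suc t) \<in> set_pmf ?N"
      unfolding M_def by (intro in_space_coupling_space(2)) auto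
    moreover have "w \<in> G (snd w (Suc t))" using w t_J by (auto simp: G_def)
    ultimately show "w \<in> (\<Union>n\<in>set_pmf ?N. G n)" by blast
  next
    fix w assume "w \<in> (\<Union>n\<in>set_pmf ?N. G n)"
    then obtain n where n: "w \<in> G n" by blast
    have "snd w j = v j" if "j \<in> J" for j
    proof -
      have "j \<noteq> Suc t" using that t_J by blast
      then show ?thesis using n that unfolding G_def by auto
    qed
    moreover have "snd w (Suc t) = n" using n by (auto simp: G_def)
    ultimately show "w \<in> {w \<in> space M. coupled_chain k m (Suc t) w \<in> S \<and> (\<forall>j\<in>J. snd w j = v j)}"
      using n by (auto simp: G_def)
  qed
  have "disjoint_family_on G (set_pmf ?N)"
    by (auto simp: disjoint_family_on_def G_def)
  then have "measure M (\<Union>n\<in>set_pmf ?N. G n) = (\<Sum>n\<in>set_pmf ?N. measure M (G n))"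
    using G fin by (intro M.finite_measure_finite_Union) auto
  also have "\<dots> = (\<Sum>n\<in>set_pmf ?N. measure \<mu> (coupling_step k m n -` S) * pmf ?N n) * (\<Prod>j\<in>J. pmf ?N (v j))"
    using G by (simp add: sum_distrib_right mult.assoc)
  also have "\<dots> = measure \<mu> S * (\<Prod>j\<in>J. pmf ?N (v j))"
    using equilibrium_measure_step[OF eq fin, of S] by simp
  finally show ?case unfolding ev using G fin by auto
qed

section \<open>Bad edges\<close>

lemma constrained_config_Suc:
  "constrained_config k m (Suc t) w = constrained_step k m (snd w (Suc t)) (constrained_config k m t w)"
  by (simp add: constrained_config_def snd_coupling_step)

text \<open>Badness is determined by \<open>Y\<^sub>t\<close> and the noise after time \<open>t\<close>, which are independent; the later values of
  the constrained configuration do not enter.\<close>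
definition bad_edge ::
    "'d::finite \<Rightarrow> nat \<Rightarrow> nat \<Rightarrow> nat \<Rightarrow> ('d config \<times> 'd config) \<times> (nat \<Rightarrow> 'd edge \<times> bool) \<Rightarrow> 'd edge \<Rightarrow> bool" where
  "bad_edge k m t s w f \<longleftrightarrow> \<not> constrained_config k m t w f \<or> (\<exists>u\<in>{t<..t + s}. snd w u = (f, False))"

context
  fixes k :: "'d::finite" and m p and \<mu> :: "('d config \<times> 'd config) pmf"
  assumes p: "0 < p" "p < 1" and ne: "box_edges m \<noteq> ({} :: 'd edge set)" and eq: "equilibrium k m p \<mu>"
begin

lemma constrained_config_disconnected:
  assumes w: "w \<in> space (coupling_space m p \<mu>)"
  shows "constrained_config k m t w \<in> disconnected k m"
proof (induction t)
  case 0
  show ?case using in_space_coupling_space(1)[OF w] eq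
    by (auto simp: constrained_config_def equilibrium_def coupling_states_def disconnected_def)
next
  case (Suc t)
  have "fst (snd w (Suc t)) \<in> box_edges m"
    using in_space_coupling_space(2)[OF w, of "Suc t"] set_pmf_coupling_noise[OF ne p]
    by (metis le_add1 mem_Times_iff plus_1_eq_Suc)
  then show ?case unfolding constrained_config_Suc by (rule constrained_step_disconnected[OF Suc])
qed

text \<open>If \<open>f\<close> closes at some step, then the value 1 was not drawn: before the step \<open>f\<close> was open, opening it changes
  nothing, and so it could not have been refused.\<close>
lemma closed_imp_bad:
  assumes w: "w \<in> space (coupling_space m p \<mu>)"
    and f: "f \<in> closed_edges m (constrained_config k m (t + s) w)"
  shows "bad_edge k m t s w f"
  using f
proof (induction s)
  case 0
  then show ?case by (simp add: bad_edge_def closed_edges_def)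
next
  case (Suc s)
  let ?Y = "constrained_config k m (t + s) w"
  obtain g b where n: "snd w (Suc (t + s)) = (g, b)" by fastforce
  show ?case
  proof (cases "?Y f")
    case False
    then have "bad_edge k m t s w f" using Suc by (auto simp: closed_edges_def)
    then show ?thesis by (auto simp: bad_edge_def)
  next
    case True
    have now: "\<not> constrained_config k m (Suc (t + s)) w f" using Suc.prems by (simp add: closed_edges_def)
    then have "f = g" using True unfolding constrained_config_Suc n
      by (auto simp: constrained_step_def split: if_splits)
    moreover have "?Y(f := True) = ?Y" by (rule fun_upd_idem) (simp add: True)
    then have "\<not> top_bottom_connected k m (?Y(f := True))"
      using constrained_config_disconnected[OF w, of "t + s"] by (simp add: disconnected_def)
    ultimately have "\<not> b" using now unfolding constrained_config_Suc n
      by (auto simp: constrained_step_def)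
    then show ?thesis using n \<open>f = g\<close> by (auto simp: bad_edge_def)
  qed
qed

lemma pivotal_event_imp_bad_chain:
  assumes w: "w \<in> space (coupling_space m p \<mu>)"
    and e: "e \<in> pivotal k m (constrained_config k m (t + s) w)"
    and piv: "\<And>r. r \<in> {t..t + s} \<Longrightarrow> pivotal k m (constrained_config k m r w) \<noteq> {}"
    and c: "c \<in> closed_cuts k m (constrained_config k m t w)"
    and far: "setdist (segment_union {e}) (segment_union c) > 2 * real n"
  shows "\<exists>xs\<in>chains m n e. distinct xs \<and> (\<forall>a\<in>set xs. bad_edge k m t s w a)"
proof -
  let ?Y = "\<lambda>r. constrained_config k m (t + r) w"
  let ?D = "\<lambda>r. closed_edges m (?Y r)"
  have "\<exists>xs\<in>chains m n e. distinct xs \<and> set xs \<subseteq> {f \<in> box_edges m. bad_edge k m t s w f}"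
  proof (rule long_bad_chain[where D = ?D and k = k and s = s and c = c])
    fix r assume r: "r \<le> s"
    show "?D r \<subseteq> {f \<in> box_edges m. bad_edge k m t s w f}"
    proof
      fix f assume f: "f \<in> ?D r"
      then have "bad_edge k m t r w f" by (rule closed_imp_bad[OF w])
      then show "f \<in> {f \<in> box_edges m. bad_edge k m t s w f}"
        using r f by (auto simp: bad_edge_def closed_edges_def)
    qed
    show "separates k m (?D r)"
      using constrained_config_disconnected[OF w, of "t + r"]
      by (simp add: disconnected_def not_connected_iff_separates)
  next
    fix r
    obtain g b where n: "snd w (Suc (t + r)) = (g, b)" by fastforce
    show "?D (Suc r) \<subseteq> ?D r \<or> ?D r \<subseteq> ?D (Suc r)"
      unfolding add_Suc_right constrained_config_Suc n by (auto simp: constrained_step_def closed_edges_def)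
  next
    fix r assume r: "r < s"
    then obtain f where "f \<in> pivotal k m (?Y r)" using piv[of "t + r"] by auto
    then show "\<exists>f. \<forall>S\<subseteq>?D r. separates k m S \<longrightarrow> f \<in> S"
      using pivotal_in_closed_separating_set by blast
  next
    show "e \<in> S" if "S \<subseteq> ?D s" "separates k m S" for S
      using pivotal_in_closed_separating_set[OF e that(2,1)] .
  next
    show "c \<subseteq> ?D 0" "separates k m c"
      using c by (auto simp: closed_cuts_def is_cut_def separates_def closed_edges_def)
  next
    fix f x y assume "f \<in> c" "x \<in> e" "y \<in> f"
    then have "x \<in> segment_union {e}" "y \<in> segment_union c"
      by (auto simp: segment_union_def intro: hull_inc)
    then show "dist x y > 2 * real n" using far setdist_le_dist by fastforce
  qed auto
  then show ?thesis by blast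
qed

text \<open>A function \<open>h\<close> selects for each edge a reason for being bad: \<open>h a = t\<close> stands for being closed in \<open>Y\<^sub>t\<close>, and any
  other value is a time at which \<open>a\<close> receives the value 0. For a fixed \<open>h\<close> the probability factorises over the
  edges (it vanishes if \<open>h\<close> selects one update time for two edges), and summing over all \<open>h\<close> gives a product of
  sums. The measurable set \<open>B\<close> is the union over \<open>h\<close>.\<close>
lemma prob_all_bad_le:
  fixes A :: "'d edge set"
  assumes F: "F \<subseteq> disconnected k m" and A: "A \<subseteq> box_edges m"
    and inv: "\<And>\<eta> a b. \<eta> \<in> configs m \<Longrightarrow> a \<in> A \<Longrightarrow> \<eta>(a := b) \<in> F \<longleftrightarrow> \<eta> \<in> F"
  defines "M \<equiv> coupling_space m p \<mu>"
  shows "\<exists>B\<in>sets M. {w \<in> space M. constrained_config k m t w \<in> F \<and> (\<forall>a\<in>A. bad_edge k m t s w a)} \<subseteq> B \<and>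
    measure M B \<le> ((1 - p) * (1 + real s / card (box_edges m :: 'd edge set))) ^ card A * measure \<mu> {z. snd z \<in> F}"
proof -
  let ?N = "coupling_noise p m :: ('d edge \<times> bool) pmf" and ?E = "box_edges m :: 'd edge set"
  interpret M: prob_space M unfolding M_def by (rule prob_space_coupling_space)
  have finA: "finite A" using A by (rule finite_subset) simp
  have fin: "finite (set_pmf ?N)" using set_pmf_coupling_noise[OF ne p] by simp
  define cost where "cost u = (if u = t then 1 - p else (1 - p) / card ?E)" for u
  define G where "G h = {w \<in> space M. constrained_config k m t w \<in> F \<and>
      (\<forall>a\<in>A. if h a = t then \<not> constrained_config k m t w a else snd w (h a) = (a, False))}" for h
  have G: "G h \<in> sets M \<and> measure M (G h) \<le> (\<Prod>a\<in>A. cost (h a)) * measure \<mu> {z. snd z \<in> F}"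
    if h: "h \<in> A \<rightarrow>\<^sub>E {t..t + s}" for h
  proof -
    define A0 A1 where "A0 = {a \<in> A. h a = t}" and "A1 = {a \<in> A. h a \<noteq> t}"
    have A01: "A = A0 \<union> A1" "A0 \<inter> A1 = {}" "finite A0" "finite A1" using finA by (auto simp: A0_def A1_def)
    have nonneg: "0 \<le> (\<Prod>a\<in>A. cost (h a)) * measure \<mu> {z. snd z \<in> F}"
      using p by (intro mult_nonneg_nonneg prod_nonneg) (auto simp: cost_def)
    show ?thesis
    proof (cases "inj_on h A1")
      case False
      then obtain a b where ab: "a \<in> A1" "b \<in> A1" "a \<noteq> b" "h a = h b" by (auto simp: inj_on_def)
      have "w \<notin> G h" for w
      proof
        assume "w \<in> G h"
        then have "snd w (h a) = (a, False)" "snd w (h b) = (b, False)"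
          using ab(1,2) by (auto simp: G_def A1_def)
        then show False using ab(3,4) by simp
      qed
      then have "G h = {}" by blast
      then show ?thesis using nonneg by simp
    next
      case True
      define v where "v j = (the_inv_into A1 h j, False)" for j
      have v: "v (h a) = (a, False)" if "a \<in> A1" for a using that True by (simp add: v_def the_inv_into_f_f)
      define S :: "('d config \<times> 'd config) set" where "S = {z. snd z \<in> F \<and> (\<forall>a\<in>A0. \<not> snd z a)}"
      have G_eq: "G h = {w \<in> space M. coupled_chain k m t w \<in> S \<and> (\<forall>j\<in>h ` A1. snd w j = v j)}"
        using v unfolding G_def S_def A01(1) ball_Un constrained_config_def
        by (auto simp: A0_def A1_def split: if_splits)
      have a_box: "a \<in> ?E" if "a \<in> A1" for a using that A by (auto simp: A1_def)
      have "G h \<in> sets M \<and> measure M (G h) = measure \<mu> S * (\<Prod>j\<in>h ` A1. pmf ?N (v j))"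
        unfolding G_eq M_def
      proof (rule present_state_indep_future_noise[OF eq fin])
        show "finite (h ` A1)" using A01 by simp
        show "h ` A1 \<subseteq> {t<..}" using h by (auto simp: A1_def PiE_def Pi_def le_neq_implies_less)
        show "v j \<in> set_pmf ?N" if "j \<in> h ` A1" for j
          using that v a_box set_pmf_coupling_noise[OF ne p] by auto
      qed
      moreover have "measure \<mu> S = (\<Prod>a\<in>A0. cost (h a)) * measure \<mu> {z. snd z \<in> F}"
      proof -
        have "measure \<mu> S = (1 - p) ^ card A0 * measure \<mu> {z. snd z \<in> F}"
          unfolding S_def by (rule equilibrium_closed_edges[OF p eq ne F]) (use A inv in \<open>auto simp: A0_def\<close>)
        also have "(1 - p) ^ card A0 = (\<Prod>a\<in>A0. cost (h a))"
          by (simp add: cost_def A0_def)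
        finally show ?thesis .
      qed
      moreover have "(\<Prod>j\<in>h ` A1. pmf ?N (v j)) = (\<Prod>a\<in>A1. cost (h a))"
        unfolding prod.reindex[OF True] o_def
        by (intro prod.cong refl) (use v a_box p in \<open>auto simp: pmf_coupling_noise cost_def A1_def\<close>)
      moreover have "(\<Prod>a\<in>A. cost (h a)) = (\<Prod>a\<in>A0. cost (h a)) * (\<Prod>a\<in>A1. cost (h a))"
        unfolding A01(1) by (rule prod.union_disjoint[OF A01(3,4,2)])
      ultimately show ?thesis by simp
    qed
  qed
  have finH: "finite (A \<rightarrow>\<^sub>E {t..t + s})" using finA by (simp add: finite_PiE)
  have "{w \<in> space M. constrained_config k m t w \<in> F \<and> (\<forall>a\<in>A. bad_edge k m t s w a)} \<subseteq> (\<Union>h\<in>A \<rightarrow>\<^sub>E {t..t + s}. G h)"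
  proof
    fix w assume w: "w \<in> {w \<in> space M. constrained_config k m t w \<in> F \<and> (\<forall>a\<in>A. bad_edge k m t s w a)}"
    have "\<forall>a\<in>A. \<exists>u\<in>{t..t + s}. if u = t then \<not> constrained_config k m t w a else snd w u = (a, False)"
    proof
      fix a assume "a \<in> A"
      then have "bad_edge k m t s w a" using w by blast
      then show "\<exists>u\<in>{t..t + s}. if u = t then \<not> constrained_config k m t w a else snd w u = (a, False)"
        unfolding bad_edge_def
      proof
        assume "\<not> constrained_config k m t w a"
        then show ?thesis by (intro bexI[of _ t]) auto
      next
        assume "\<exists>u\<in>{t<..t + s}. snd w u = (a, False)"
        then obtain u where "u \<in> {t<..t + s}" "snd w u = (a, False)" by blast
        then show ?thesis by (intro bexI[of _ u]) auto
      qed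
    qed
    then obtain h where h: "\<And>a. a \<in> A \<Longrightarrow> h a \<in> {t..t + s} \<and>
        (if h a = t then \<not> constrained_config k m t w a else snd w (h a) = (a, False))" by metis
    have "restrict h A \<in> A \<rightarrow>\<^sub>E {t..t + s}" using h by auto
    moreover have "w \<in> G (restrict h A)" using h w by (simp add: G_def)
    ultimately show "w \<in> (\<Union>h\<in>A \<rightarrow>\<^sub>E {t..t + s}. G h)" by blast
  qed
  moreover have "(\<Union>h\<in>A \<rightarrow>\<^sub>E {t..t + s}. G h) \<in> sets M"
    using G finH by (intro sets.finite_UN) auto
  moreover have "measure M (\<Union>h\<in>A \<rightarrow>\<^sub>E {t..t + s}. G h) \<le>
      ((1 - p) * (1 + real s / card ?E)) ^ card A * measure \<mu> {z. snd z \<in> F}"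
  proof -
    have "measure M (\<Union>h\<in>A \<rightarrow>\<^sub>E {t..t + s}. G h) \<le> (\<Sum>h\<in>A \<rightarrow>\<^sub>E {t..t + s}. measure M (G h))"
      using G finH by (intro M.finite_measure_subadditive_finite) auto
    also have "\<dots> \<le> (\<Sum>h\<in>A \<rightarrow>\<^sub>E {t..t + s}. (\<Prod>a\<in>A. cost (h a)) * measure \<mu> {z. snd z \<in> F})"
      using G by (intro sum_mono) blast
    also have "\<dots> = (\<Prod>a\<in>A. \<Sum>u\<in>{t..t + s}. cost u) * measure \<mu> {z. snd z \<in> F}"
      unfolding sum_distrib_right[symmetric] using finA by (subst prod_sum_PiE) auto
    also have "(\<Sum>u\<in>{t..t + s}. cost u) = (1 - p) * (1 + real s / card ?E)"
    proof -
      have "(\<Sum>u\<in>{t..t + s}. cost u) = cost t + (\<Sum>u\<in>{t<..t + s}. cost u)"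
        by (subst sum.head) auto
      also have "(\<Sum>u\<in>{t<..t + s}. cost u) = (\<Sum>u\<in>{t<..t + s}. (1 - p) / card ?E)"
        by (intro sum.cong) (auto simp: cost_def)
      finally show ?thesis by (simp add: cost_def algebra_simps)
    qed
    finally show ?thesis by simp
  qed
  ultimately show ?thesis by blast
qed

end

section \<open>The speed estimate\<close>

text \<open>An edge near \<open>e\<close> cannot belong to a cut far from \<open>e\<close>, so its state has no influence on the cut being closed.\<close>
lemma far_cut_event_upd:
  assumes a: "\<exists>x\<in>e. \<exists>y\<in>a. dist x y < l" "a \<in> box_edges m"
    and \<eta>: "\<eta> \<in> disconnected k m" "c \<in> closed_cuts k m \<eta>" "setdist (segment_union {e}) (segment_union c) \<ge> l"
  shows "\<eta>(a := b) \<in> disconnected k m \<and> c \<in> closed_cuts k m (\<eta>(a := b))"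
proof -
  have "a \<notin> c"
  proof
    assume "a \<in> c"
    obtain x y where xy: "x \<in> e" "y \<in> a" "dist x y < l" using a by blast
    have "x \<in> segment_union {e}" "y \<in> segment_union c"
      using xy \<open>a \<in> c\<close> by (auto simp: segment_union_def intro: hull_inc)
    then show False using setdist_le_dist[of x "segment_union {e}" y "segment_union c"] xy(3) \<eta>(3) by simp
  qed
  then have "(\<eta>(a := b)) f = \<eta> f" if "f \<in> c" for f using that by auto
  then have c: "c \<in> closed_cuts k m (\<eta>(a := b))" using \<eta>(2) unfolding closed_cuts_def by simp
  then have sep: "separates k m c" and "\<forall>f\<in>c. \<not> (\<eta>(a := b)) f"
    unfolding closed_cuts_def is_cut_def by simp_all
  then have "c \<subseteq> closed_edges m (\<eta>(a := b))"
    unfolding separates_def closed_edges_def by blast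
  then have "separates k m (closed_edges m (\<eta>(a := b)))"
    by (rule separates_mono[OF sep]) (auto simp: closed_edges_def)
  then show ?thesis using c \<eta>(1) a(2) by (simp add: disconnected_def not_connected_iff_separates configs_upd)
qed

theorem proposition4p1:
  assumes dim: "CARD('d::finite) \<ge> 2"
  shows "\<exists>p'::real. p' < 1 \<and>
    (\<forall>(k::'d) (p::real) (m::nat) (\<mu> :: ('d config \<times> 'd config) pmf)
        (l::real) (t::nat) (s::nat) (e :: 'd edge).
      p' \<le> p \<longrightarrow> 0 < p \<longrightarrow> p < 1 \<longrightarrow> 0 < m \<longrightarrow> equilibrium k m p \<mu> \<longrightarrow> 2 \<le> l \<longrightarrow>
      s \<le> card (Box m \<inter> lattice :: (real ^ 'd) set) \<longrightarrow>
      e \<in> box_edges m \<longrightarrow> setdist (segment_union {e}) (- Box m) > l \<longrightarrow>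
      \<P>(w in coupling_space m p \<mu>. \<exists>c\<in>closed_cuts k m (constrained_config k m t w).
          setdist (segment_union {e}) (segment_union c) \<ge> l) > 0 \<longrightarrow>
      \<P>(w in coupling_space m p \<mu>.
          e \<in> pivotal k m (constrained_config k m (t + s) w) \<and> (\<forall>r\<in>{t..t + s}. pivotal k m (constrained_config k m r w) \<noteq> {})
        \<bar> \<exists>c\<in>closed_cuts k m (constrained_config k m t w). setdist (segment_union {e}) (segment_union c) \<ge> l)
      \<le> exp (- l))"
proof -
  define K :: real where "K = 2 * (2 * CARD('d) + 1)\<^sup>2"
  have K: "K \<ge> 1"
  proof -
    have "1 \<le> 2 * (2 * CARD('d) + 1)\<^sup>2" by simp
    then show ?thesis unfolding K_def by linarith
  qed
  \<comment> \<open>chosen such that \<open>3 * K * (1 - p) \<le> exp (- 2)\<close> whenever \<open>p' \<le> p\<close>: each of the at least \<open>l / 2\<close> edges of a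
      chain has to contribute a factor \<open>exp (- 2)\<close>\<close>
  define p' where "p' = 1 - exp (- 2) / (3 * K)"
  have "p' < 1" using K by (simp add: p'_def)
  moreover have "\<P>(w in coupling_space m p \<mu>.
          e \<in> pivotal k m (constrained_config k m (t + s) w) \<and> (\<forall>r\<in>{t..t + s}. pivotal k m (constrained_config k m r w) \<noteq> {})
        \<bar> \<exists>c\<in>closed_cuts k m (constrained_config k m t w). setdist (segment_union {e}) (segment_union c) \<ge> l)
      \<le> exp (- l)"
    if p': "p' \<le> p" and p: "0 < p" "p < 1" and m: "0 < m" and eq: "equilibrium k m p \<mu>" and l: "2 \<le> l"
      and s: "s \<le> card (Box m \<inter> lattice :: (real ^ 'd) set)" and e: "e \<in> box_edges m"
      and pos: "\<P>(w in coupling_space m p \<mu>. \<exists>c\<in>closed_cuts k m (constrained_config k m t w).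
          setdist (segment_union {e}) (segment_union c) \<ge> l) > 0"
    for k :: 'd and p m and \<mu> :: "('d config \<times> 'd config) pmf" and l t s and e :: "'d edge"
  proof -
    let ?Y = "constrained_config k m" and ?far = "\<lambda>c. setdist (segment_union {e}) (segment_union c) \<ge> l"
    let ?E = "box_edges m :: 'd edge set"
    define M where "M = coupling_space m p \<mu>"
    interpret M: prob_space M unfolding M_def by (rule prob_space_coupling_space)
    have ne: "?E \<noteq> {}" using e by auto
    note fin = set_pmf_coupling_noise[OF ne p]
    define F where "F = {\<eta> \<in> disconnected k m. \<exists>c\<in>closed_cuts k m \<eta>. ?far c}"
    define q where "q = measure \<mu> {z. snd z \<in> F}"
    have cond_eq: "{w \<in> space M. \<exists>c\<in>closed_cuts k m (?Y t w). ?far c} =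
        {w \<in> space M. coupled_chain k m t w \<in> {z. snd z \<in> F} \<and> (\<forall>j\<in>{}. snd w j = undefined j)}"
      using constrained_config_disconnected[OF p ne eq] unfolding M_def F_def
      by (auto simp flip: constrained_config_def)
    have q: "measure M {w \<in> space M. \<exists>c\<in>closed_cuts k m (?Y t w). ?far c} = q"
      using present_state_indep_future_noise[OF eq, of "{}" t undefined "{z. snd z \<in> F}"] fin
      unfolding cond_eq q_def unfolding M_def by simp
    \<comment> \<open>the largest number of steps that a chain can make while it provably stays at distance less than \<open>l\<close>
        from \<open>e\<close>: a step covers a distance of at most 2\<close>
    define n where "n = nat \<lceil>l / 2\<rceil> - 1"
    have n: "2 * real n < l" "l \<le> 2 * real (Suc n)"
    proof -
      have "1 \<le> \<lceil>l / 2\<rceil>" using l by linarith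
      then have "Suc n = nat \<lceil>l / 2\<rceil>" by (simp add: n_def)
      then have "real (Suc n) = of_int \<lceil>l / 2\<rceil>" using \<open>1 \<le> \<lceil>l / 2\<rceil>\<close> by simp
      then have n_eq: "real n = of_int \<lceil>l / 2\<rceil> - 1" by simp
      define z :: real where "z = of_int \<lceil>l / 2\<rceil>"
      have z: "z - 1 < l / 2" "l / 2 \<le> z" unfolding z_def using ceiling_correct[of "l / 2"] by blast+
      have z_eq: "real n = z - 1" using n_eq by (simp only: z_def)
      show "2 * real n < l" using z z_eq by simp
      show "l \<le> 2 * real (Suc n)" using z z_eq by simp
    qed
    define X where "X = {xs \<in> chains m n e. distinct xs}"
    have chains: "finite (chains m n e)" "real (card (chains m n e)) \<le> K ^ n"
      using card_chains_le[OF e, of n] unfolding K_def by (simp, metis of_nat_le_iff of_nat_power)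
    then have X: "finite X" "real (card X) \<le> K ^ n"
      using card_mono[OF chains(1), of X] by (auto simp: X_def)
    \<comment> \<open>an edge is selected at most twice on average during the window\<close>
    have s_le: "real s / card ?E \<le> 2"
    proof -
      have "real s \<le> 2 * card ?E" using s card_lattice_Int_Box_le[OF m, where 'd = 'd] by linarith
      moreover have "card ?E > 0" using ne by (simp add: card_gt_0_iff)
      ultimately show ?thesis by (simp add: divide_le_eq)
    qed
    have "\<forall>xs\<in>X. \<exists>B. B \<in> sets M \<and> {w \<in> space M. ?Y t w \<in> F \<and> (\<forall>a\<in>set xs. bad_edge k m t s w a)} \<subseteq> B \<and>
        measure M B \<le> (3 * (1 - p)) ^ Suc n * q"
    proof
      fix xs assume xs: "xs \<in> X"
      have len: "length ys = Suc j" if "ys \<in> chains m j f" for ys :: "'d edge list" and j f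
        using that by (induction j arbitrary: f ys) auto
      have card: "card (set xs) = Suc n" using xs len[of xs n e] by (simp add: X_def distinct_card)
      have close: "a \<in> box_edges m \<and> (\<exists>x\<in>e. \<exists>y\<in>a. dist x y < l)" if "a \<in> set xs" for a
      proof -
        obtain x where x: "x \<in> e" using e by (auto elim: box_edgeE)
        show ?thesis using chain_close[of xs m n e a] xs that e x n(1) by (force simp: X_def)
      qed
      have inv: "\<eta>(a := b) \<in> F \<longleftrightarrow> \<eta> \<in> F" if "\<eta> \<in> configs m" "a \<in> set xs" for \<eta> a b
      proof
        show "\<eta>(a := b) \<in> F" if "\<eta> \<in> F"
          using far_cut_event_upd[of e a l m \<eta> k _ b] close[OF \<open>a \<in> set xs\<close>] that unfolding F_def by blast
        show "\<eta> \<in> F" if "\<eta>(a := b) \<in> F"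
        proof -
          have "(\<eta>(a := b))(a := \<eta> a) = \<eta>" by simp
          then show ?thesis
            using far_cut_event_upd[of e a l m "\<eta>(a := b)" k _ "\<eta> a"] close[OF \<open>a \<in> set xs\<close>] that
            unfolding F_def mem_Collect_eq by metis
        qed
      qed
      have "(1 - p) * (1 + real s / card ?E) \<le> (1 - p) * 3"
        using s_le p by (intro mult_left_mono) auto
      then have "((1 - p) * (1 + real s / card ?E)) ^ card (set xs) * q \<le> (3 * (1 - p)) ^ Suc n * q"
        unfolding card using p
        by (intro mult_right_mono power_mono) (auto simp: q_def mult.commute[of 3] intro!: mult_nonneg_nonneg)
      moreover have "\<exists>B\<in>sets M. {w \<in> space M. ?Y t w \<in> F \<and> (\<forall>a\<in>set xs. bad_edge k m t s w a)} \<subseteq> B \<and>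
          measure M B \<le> ((1 - p) * (1 + real s / card ?E)) ^ card (set xs) * q"
        unfolding M_def q_def
        by (rule prob_all_bad_le[OF p ne eq]) (use inv close in \<open>auto simp: F_def\<close>)
      ultimately show "\<exists>B. B \<in> sets M \<and> {w \<in> space M. ?Y t w \<in> F \<and> (\<forall>a\<in>set xs. bad_edge k m t s w a)} \<subseteq> B \<and>
          measure M B \<le> (3 * (1 - p)) ^ Suc n * q" by (blast intro: order_trans)
    qed
    from bchoice[OF this] obtain W where W: "\<And>xs. xs \<in> X \<Longrightarrow> W xs \<in> sets M \<and>
        {w \<in> space M. ?Y t w \<in> F \<and> (\<forall>a\<in>set xs. bad_edge k m t s w a)} \<subseteq> W xs \<and>
        measure M (W xs) \<le> (3 * (1 - p)) ^ Suc n * q" by blast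
    have "measure M {w \<in> space M. (e \<in> pivotal k m (?Y (t + s) w) \<and> (\<forall>r\<in>{t..t + s}. pivotal k m (?Y r w) \<noteq> {})) \<and>
        (\<exists>c\<in>closed_cuts k m (?Y t w). ?far c)} \<le> measure M (\<Union>xs\<in>X. W xs)"
    proof (intro M.finite_measure_mono subsetI)
      fix w assume w: "w \<in> {w \<in> space M. (e \<in> pivotal k m (?Y (t + s) w) \<and> (\<forall>r\<in>{t..t + s}. pivotal k m (?Y r w) \<noteq> {})) \<and>
        (\<exists>c\<in>closed_cuts k m (?Y t w). ?far c)}"
      then have sp: "w \<in> space (coupling_space m p \<mu>)" by (simp add: M_def)
      obtain c where c: "c \<in> closed_cuts k m (?Y t w)" "?far c" using w by blast
      then have "2 * real n < setdist (segment_union {e}) (segment_union c)" using n(1) by linarith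
      then have "\<exists>xs\<in>chains m n e. distinct xs \<and> (\<forall>a\<in>set xs. bad_edge k m t s w a)"
        using pivotal_event_imp_bad_chain[OF p ne eq sp _ _ c(1), of e s n] w by blast
      then obtain xs where xs: "xs \<in> X" "\<And>a. a \<in> set xs \<Longrightarrow> bad_edge k m t s w a"
        by (auto simp: X_def)
      have "?Y t w \<in> F"
        using c constrained_config_disconnected[OF p ne eq sp] by (auto simp: F_def)
      then have "w \<in> W xs" using W[OF xs(1)] xs(2) w by blast
      then show "w \<in> (\<Union>xs\<in>X. W xs)" using xs(1) by blast
    qed (use X W in \<open>auto intro: sets.finite_UN\<close>)
    also have "\<dots> \<le> (\<Sum>xs\<in>X. measure M (W xs))"
      using X W by (intro M.finite_measure_subadditive_finite) auto
    also have "\<dots> \<le> (\<Sum>xs\<in>X. (3 * (1 - p)) ^ Suc n * q)" using W by (intro sum_mono) blast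
    also have "\<dots> = real (card X) * (3 * (1 - p)) ^ Suc n * q" by simp
    also have "\<dots> \<le> K ^ Suc n * (3 * (1 - p)) ^ Suc n * q"
    proof -
      have "K ^ n \<le> K ^ Suc n" using K by (intro power_increasing) auto
      then show ?thesis using X(2) p by (intro mult_right_mono) (auto simp: q_def)
    qed
    also have "\<dots> = (3 * K * (1 - p)) ^ Suc n * q" by (simp add: power_mult_distrib mult_ac)
    also have "\<dots> \<le> exp (- 2) ^ Suc n * q"
    proof -
      have "3 * K * (1 - p) \<le> exp (- 2)" using p' K unfolding p'_def by (simp add: field_simps)
      then show ?thesis using K p by (intro mult_right_mono power_mono) (auto simp: q_def)
    qed
    also have "exp (- 2) ^ Suc n = exp (- (2 * real (Suc n)))"
      by (simp add: exp_of_nat_mult[symmetric] mult.commute del: power_Suc of_nat_Suc)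
    also have "\<dots> * q \<le> exp (- l) * q" using n(2) by (intro mult_right_mono) (auto simp: q_def)
    finally show ?thesis
      using pos unfolding cond_prob_def M_def[symmetric] q by (simp add: divide_le_eq)
  qed
  ultimately show ?thesis by blast
qed

end
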